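(* Let $G$ be a cubic graph with base embedding $\widehat{\Pi}$, and let $\Pi$ be an embedding of $G$ whose unstable dual $G^*_\Pi$ has a cut-vertex $f$. Suppose that $G^*_\Pi$ is the union of zero-homologous subgraphs $H_1,\dots,H_k$, where $V(H_i)\cap V(H_j)=\{f\}$ for all $1\le i<j\le k$. If the edges of each $H_i$ appear consecutively in the local rotation (of $G^*_\Pi$) around $f$, then there exist embeddings $\Pi_1,\dots,\Pi_k$ of $G$ such that $G^*_{\Pi_i}=H_i$ for $i=1,\dots,k$. Furthermore, $$\Delta g(\Pi)=\sum_{i=1}^k\Delta g(\Pi_i).$$
   Context: $G$ is a finite connected graph. All embeddings are 2-cell embeddings in closed orientable surfaces and are described by rotation systems: an embedding $\Pi$ assigns to each vertex $v$ a clockwise cyclic ordering $\pi_v$ of the edges incident with $v$. $g(\Pi)$ is the genus of the surface of $\Pi$. Fix a base embedding $\widehat{\Pi}$ with local rotations $\widehat{\pi}_v$. A vertex $v$ is $\Pi$-unstable if $\pi_v\neq\widehat{\pi}_v$; an edge is $\Pi$-unstable if exactly one of its endpoints is $\Pi$-unstable; a face of $\widehat{\Pi}$ is $\Pi$-unstable if its boundary contains at least one $\Pi$-unstable edge. Let $G^*$ be the dual graph of $G$ with respect to $\widehat{\Pi}$, embedded in the same surface as $\widehat{\Pi}$ (it may have loops and parallel edges). The $\Pi$-unstable dual $G^*_\Pi$ is the subgraph of $G^*$ whose vertices are the $\Pi$-unstable faces and whose edges are the dual edges of the $\Pi$-unstable edges; its local rotation at a vertex is the cyclic order of its edges inherited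 from the embedded graph $G^*$. A subgraph $H^*$ of $G^*$ is zero-homologous if its edges separate the surface into two parts $A\cup B$ with $\partial A=\partial B=E(H^* )$; equivalently, $E(H^* )$ is the mod-2 sum of the boundaries of some set of faces of $G^*$. Finally, $\Delta g(\Pi)=g(\Pi)-g(\widehat{\Pi})$.
   Formalization: The formal theorem also assumes that no H_i has an isolated vertex (H_i = ({f}, ∅) is the unstable dual of no embedding) and that distinct H_i share no edges (if loops at f are shared, the genus formula can fail). *)

theory Defs
  imports "Graph_Theory.Graph_Theory"
begin

text \<open>
  An undirected multigraph (loops and parallel edges allowed) is a \<^locale>\<open>bidirected_digraph\<close>
  \<open>G\<close> with arc reversal \<open>arev\<close>: an edge is a pair \<open>{a, arev a}\<close> of mutually reverse arcs, and the
  arcs in \<open>out_arcs G v\<close> are the edge ends at \<open>v\<close>, so that a loop at \<open>v\<close> contributes two of them.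
\<close>

definition cubic :: "('a, 'b) pre_digraph \<Rightarrow> bool" where
  "cubic G \<longleftrightarrow> (\<forall>v\<in>verts G. out_degree G v = 3)"

definition undirected_subgraph ::
    "('b \<Rightarrow> 'b) \<Rightarrow> ('a, 'b) pre_digraph \<Rightarrow> ('a, 'b) pre_digraph \<Rightarrow> bool" where
  "undirected_subgraph arev H G \<longleftrightarrow> subgraph H G \<and> arev ` arcs H \<subseteq> arcs H"

text \<open>
  For a graph whose arc set is closed under reversal the strong components are the connected
  components.
\<close>

definition cut_vertex :: "('a, 'b) pre_digraph \<Rightarrow> 'a \<Rightarrow> bool" where
  "cut_vertex G v \<longleftrightarrow> v \<in> verts G \<and>
     card (pre_digraph.sccs (pre_digraph.del_vert G v)) > card (pre_digraph.sccs G)"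


section \<open>Rotation systems\<close>

text \<open>
  A rotation system is a single permutation \<open>\<pi>\<close> of the arcs that permutes the arcs leaving each
  vertex \<open>v\<close> in one cycle; the restriction of \<open>\<pi>\<close> to \<open>out_arcs G v\<close> is the clockwise local
  rotation at \<open>v\<close>.
\<close>

definition rotation_system :: "('a, 'b) pre_digraph \<Rightarrow> ('b \<Rightarrow> 'b) \<Rightarrow> bool" where
  "rotation_system G \<pi> \<longleftrightarrow> \<pi> permutes arcs G \<and>
     (\<forall>v\<in>verts G. out_arcs G v \<noteq> {} \<longrightarrow> cyclic_on \<pi> (out_arcs G v))"

text \<open>
  Having traversed \<open>a\<close>, a facial walk continues with the arc that follows \<open>arev a\<close> in the rotation
  at the head of \<open>a\<close>, which keeps the face on the left. A face is represented by the set of arcs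
  that have it on their left; an edge lies on its boundary if one of its two arcs is in this set.
\<close>

definition face_of :: "('b \<Rightarrow> 'b) \<Rightarrow> ('b \<Rightarrow> 'b) \<Rightarrow> 'b \<Rightarrow> 'b set" where
  "face_of arev \<pi> a = orbit (\<pi> \<circ> arev) a"

definition faces :: "('a, 'b) pre_digraph \<Rightarrow> ('b \<Rightarrow> 'b) \<Rightarrow> ('b \<Rightarrow> 'b) \<Rightarrow> 'b set set" where
  "faces G arev \<pi> = face_of arev \<pi> ` arcs G"

definition edges :: "('a, 'b) pre_digraph \<Rightarrow> ('b \<Rightarrow> 'b) \<Rightarrow> 'b set set" where
  "edges G arev = (\<lambda>a. {a, arev a}) ` arcs G"

definition euler_char :: "('a, 'b) pre_digraph \<Rightarrow> ('b \<Rightarrow> 'b) \<Rightarrow> ('b \<Rightarrow> 'b) \<Rightarrow> int" where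
  "euler_char G arev \<pi> = int (card (verts G)) - int (card (edges G arev)) + int (card (faces G arev \<pi>))"

text \<open>
  For connected \<open>G\<close> the embedding is a 2-cell embedding in the closed orientable surface with
  \<open>V - E + F = 2 - 2 g\<close>. The quotient is taken in the rationals to avoid truncation.
\<close>

definition genus :: "('a, 'b) pre_digraph \<Rightarrow> ('b \<Rightarrow> 'b) \<Rightarrow> ('b \<Rightarrow> 'b) \<Rightarrow> rat" where
  "genus G arev \<pi> = (2 - of_int (euler_char G arev \<pi>)) / 2"

definition genus_diff ::
    "('a, 'b) pre_digraph \<Rightarrow> ('b \<Rightarrow> 'b) \<Rightarrow> ('b \<Rightarrow> 'b) \<Rightarrow> ('b \<Rightarrow> 'b) \<Rightarrow> rat" where
  "genus_diff G arev \<pi>0 \<pi> = genus G arev \<pi> - genus G arev \<pi>0"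


section \<open>The dual graph\<close>

text \<open>
  The dual arc of \<open>a\<close> is denoted by \<open>a\<close> again; it crosses \<open>a\<close> from left to right, so the
  reversal on the dual is \<open>arev\<close> as well.
\<close>

definition dual_graph ::
    "('a, 'b) pre_digraph \<Rightarrow> ('b \<Rightarrow> 'b) \<Rightarrow> ('b \<Rightarrow> 'b) \<Rightarrow> ('b set, 'b) pre_digraph" where
  "dual_graph G arev \<pi> =
     \<lparr> verts = faces G arev \<pi>, arcs = arcs G,
       tail = face_of arev \<pi>, head = (\<lambda>a. face_of arev \<pi> (arev a)) \<rparr>"

text \<open>
  The edge ends of the dual at a face occur around it in the order of the facial walk. With the
  face on the left of its arcs this order is counterclockwise; taking it as the rotation describes
  the dual in the same surface with the orientation reversed, which affects neither the set of
  faces nor which edges are consecutive. The faces of the dual then are the orbits of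
  \<open>\<pi> \<circ> arev \<circ> arev = \<pi>\<close>, that is, the sets \<open>out_arcs G v\<close>.
\<close>

definition dual_rotation :: "('b \<Rightarrow> 'b) \<Rightarrow> ('b \<Rightarrow> 'b) \<Rightarrow> 'b \<Rightarrow> 'b" where
  "dual_rotation arev \<pi> = \<pi> \<circ> arev"

text \<open>
  The rotation that a subgraph with arc set \<open>A\<close> inherits: skip the arcs outside \<open>A\<close>.
\<close>

definition inherited_rotation :: "('b \<Rightarrow> 'b) \<Rightarrow> 'b set \<Rightarrow> 'b \<Rightarrow> 'b" where
  "inherited_rotation \<rho> A a = (\<rho> ^^ (LEAST n. 0 < n \<and> (\<rho> ^^ n) a \<in> A)) a"

definition consecutive_in :: "('b \<Rightarrow> 'b) \<Rightarrow> 'b set \<Rightarrow> bool" where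
  "consecutive_in \<rho> B \<longleftrightarrow> (\<exists>a m. B = {(\<rho> ^^ j) a | j. j < m})"

text \<open>
  \<open>D\<close> is a graph embedded with rotation system \<open>\<rho>\<close>. An edge \<open>{a, arev a}\<close> occurs in the boundary
  walk of a face \<open>B\<close> once for each of its arcs that lies in \<open>B\<close>; the edge set of \<open>H\<close> is the mod-2
  sum of the boundaries of the faces in \<open>S\<close>.
\<close>

definition zero_homologous ::
    "('a, 'b) pre_digraph \<Rightarrow> ('b \<Rightarrow> 'b) \<Rightarrow> ('b \<Rightarrow> 'b) \<Rightarrow> ('a, 'b) pre_digraph \<Rightarrow> bool" where
  "zero_homologous D arev \<rho> H \<longleftrightarrow>
     (\<exists>S \<subseteq> faces D arev \<rho>. arcs H = {a \<in> arcs D. odd (\<Sum>B\<in>S. card (B \<inter> {a, arev a}))})"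


section \<open>The unstable dual\<close>

text \<open>Here \<open>\<pi>0\<close> is the base embedding.\<close>

definition unstable_vertex ::
    "('a, 'b) pre_digraph \<Rightarrow> ('b \<Rightarrow> 'b) \<Rightarrow> ('b \<Rightarrow> 'b) \<Rightarrow> 'a \<Rightarrow> bool" where
  "unstable_vertex G \<pi>0 \<pi> v \<longleftrightarrow> v \<in> verts G \<and> (\<exists>a\<in>out_arcs G v. \<pi> a \<noteq> \<pi>0 a)"

definition unstable_arcs ::
    "('a, 'b) pre_digraph \<Rightarrow> ('b \<Rightarrow> 'b) \<Rightarrow> ('b \<Rightarrow> 'b) \<Rightarrow> 'b set" where
  "unstable_arcs G \<pi>0 \<pi> =
     {a \<in> arcs G. unstable_vertex G \<pi>0 \<pi> (tail G a) \<noteq> unstable_vertex G \<pi>0 \<pi> (head G a)}"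

definition unstable_faces ::
    "('a, 'b) pre_digraph \<Rightarrow> ('b \<Rightarrow> 'b) \<Rightarrow> ('b \<Rightarrow> 'b) \<Rightarrow> ('b \<Rightarrow> 'b) \<Rightarrow> 'b set set" where
  "unstable_faces G arev \<pi>0 \<pi> = {F \<in> faces G arev \<pi>0. F \<inter> unstable_arcs G \<pi>0 \<pi> \<noteq> {}}"

definition unstable_dual ::
    "('a, 'b) pre_digraph \<Rightarrow> ('b \<Rightarrow> 'b) \<Rightarrow> ('b \<Rightarrow> 'b) \<Rightarrow> ('b \<Rightarrow> 'b) \<Rightarrow> ('b set, 'b) pre_digraph" where
  "unstable_dual G arev \<pi>0 \<pi> =
     (dual_graph G arev \<pi>0)
       \<lparr> verts := unstable_faces G arev \<pi>0 \<pi>, arcs := unstable_arcs G \<pi>0 \<pi> \<rparr>"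

definition unstable_rotation ::
    "('a, 'b) pre_digraph \<Rightarrow> ('b \<Rightarrow> 'b) \<Rightarrow> ('b \<Rightarrow> 'b) \<Rightarrow> ('b \<Rightarrow> 'b) \<Rightarrow> 'b \<Rightarrow> 'b" where
  "unstable_rotation G arev \<pi>0 \<pi> =
     inherited_rotation (dual_rotation arev \<pi>0) (unstable_arcs G \<pi>0 \<pi>)"

end

theory Submission
  imports Defs
begin

text \<open>
  In a cubic graph an embedding is the base embedding with the rotation inverted at a set \<open>U\<close> of
  vertices. Its ribbon surface is that of the base embedding with a twist in every edge of the cut
  \<open>\<delta>(U)\<close>, so its facial walks are the closed strands obtained by following the corners of the base
  embedding and changing sides at each edge of \<open>\<delta>(U)\<close>. A zero-homologous subgraph of the dual is
  such a cut. If the arcs of one summand \<open>B\<close> fill an interval of the facial walk \<open>f\<close> and the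
  remaining arcs \<open>C\<close> fill the complementary interval, cut \<open>f\<close> into these two walks. The strands
  split into those meeting \<open>B\<close> and those meeting \<open>C\<close>, and undoing the cut merges one strand
  of each kind, whether or not the edges of \<open>B\<close> and \<open>C\<close> are twisted. Hence the change in the number
  of faces is additive.
\<close>

section \<open>Cycles formed by two involutions\<close>

lemma even_card_involution:
  assumes "finite S" and "\<And>x. x \<in> S \<Longrightarrow> h x \<in> S \<and> h (h x) = x \<and> h x \<noteq> x"
  shows "even (card S)"
  using assms
proof (induction S rule: finite_psubset_induct)
  case (psubset S)
  show ?case
  proof (cases "S = {}")
    case False
    then obtain x where x: "x \<in> S" by blast
    have hx: "h x \<in> S" "h x \<noteq> x" "h (h x) = x" using psubset.prems[OF x] by auto
    have "even (card (S - {x, h x}))"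
    proof (rule psubset.IH)
      show "S - {x, h x} \<subset> S" using x by blast
      show "h y \<in> S - {x, h x} \<and> h (h y) = y \<and> h y \<noteq> y" if "y \<in> S - {x, h x}" for y
        using that psubset.prems[of y] hx by force
    qed
    moreover have "card S = card (S - {x, h x}) + 2"
    proof -
      have "card {x, h x} \<le> card S" using x hx psubset.hyps by (intro card_mono) auto
      then show ?thesis using card_Diff_subset[of "{x, h x}" S] x hx by simp
    qed
    ultimately show ?thesis by simp
  qed simp
qed

section \<open>Reachability classes of a relation and the effect of one extra link\<close>

lemma rtrancl_Image_closed:
  assumes "L `` Z \<subseteq> Z" and "x \<in> Z"
  shows "L\<^sup>* `` {x} \<subseteq> Z"
proof
  fix y assume "y \<in> L\<^sup>* `` {x}"
  then have "(x, y) \<in> L\<^sup>*" by simp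
  then show "y \<in> Z" by induction (use assms in auto)
qed

text \<open>A path that starts in a closed set never leaves it, so only the links issuing from that
  set matter. This allows a twist set to be replaced by its trace on an invariant part.\<close>

lemma rtrancl_Image_cong:
  assumes "L `` Z \<subseteq> Z" and "\<And>y z. y \<in> Z \<Longrightarrow> (y, z) \<in> L \<longleftrightarrow> (y, z) \<in> M" and "x \<in> Z"
  shows "L\<^sup>* `` {x} = M\<^sup>* `` {x}"
proof -
  have cl: "M `` Z \<subseteq> Z" using assms(1,2) by blast
  have "(x, y) \<in> M\<^sup>*" if "(x, y) \<in> L\<^sup>*" for y
    using that
  proof induction
    case (step y z)
    then have "y \<in> Z" using rtrancl_Image_closed[OF assms(1,3)] by auto
    then show ?case using step assms(2) by (meson rtrancl.rtrancl_into_rtrancl)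
  qed simp
  moreover have "(x, y) \<in> L\<^sup>*" if "(x, y) \<in> M\<^sup>*" for y
    using that
  proof induction
    case (step y z)
    then have "y \<in> Z" using rtrancl_Image_closed[OF cl assms(3)] by auto
    then show ?case using step assms(2) by (meson rtrancl.rtrancl_into_rtrancl)
  qed simp
  ultimately show ?thesis by blast
qed

text \<open>The new link fuses the classes of \<open>p\<close> and \<open>q\<close> and touches no
  other class, so exactly one class is lost.\<close>

lemma card_quotient_join:
  assumes sym: "sym L" and fin: "finite X"
    and p: "p \<in> X" and q: "q \<in> X" and pq: "(p, q) \<notin> L\<^sup>*"
  shows "card (X // (L \<union> {(p, q), (q, p)})\<^sup>*) + 1 = card (X // L\<^sup>*)"
proof -
  let ?rL = "L\<^sup>*" and ?M = "L \<union> {(p, q), (q, p)}"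
  let ?rM = "?M\<^sup>*"
  let ?c = "?rL `` {p} \<union> ?rL `` {q}"
  have sym0: "(x, y) \<in> ?rL \<Longrightarrow> (y, x) \<in> ?rL" for x y
    using sym_rtrancl[OF sym] by (meson symD)
  have tr0: "(x, y) \<in> ?rL \<Longrightarrow> (y, z) \<in> ?rL \<Longrightarrow> (x, z) \<in> ?rL" for x y z
    by (rule rtrancl_trans)
  have symr: "(x, y) \<in> ?rM \<Longrightarrow> (y, x) \<in> ?rM" for x y
  proof -
    have "sym ?M" using sym by (auto simp: sym_def)
    then have "sym ?rM" by (rule sym_rtrancl)
    then show "(x, y) \<in> ?rM \<Longrightarrow> (y, x) \<in> ?rM" by (rule symD)
  qed
  have sub: "(x, y) \<in> ?rL \<Longrightarrow> (x, y) \<in> ?rM" for x y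
    using rtrancl_mono[of L ?M] by blast
  have pqr: "(p, q) \<in> ?rM" by blast
  have inside: "?rM `` {x} = ?c" if x: "x \<in> ?c" for x
  proof
    have "?M `` ?c \<subseteq> ?c" by (auto intro: rtrancl_into_rtrancl)
    then show "?rM `` {x} \<subseteq> ?c" using x by (rule rtrancl_Image_closed)
    have "(x, p) \<in> ?rM \<or> (x, q) \<in> ?rM" using x sub symr by blast
    then have "(x, p) \<in> ?rM" "(x, q) \<in> ?rM"
      using symr[OF pqr] pqr by (auto intro: rtrancl_trans)
    then show "?c \<subseteq> ?rM `` {x}" using sub by (auto intro: rtrancl_trans)
  qed
  have outside: "?rM `` {x} = ?rL `` {x}" if x: "x \<notin> ?c" for x
  proof -
    have "?rL `` {x} = ?rM `` {x}"
    \<comment> \<open>Both extra links start in \<open>?c\<close>, so outside \<open>?c\<close> the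
      two relations agree.\<close>
    proof (rule rtrancl_Image_cong[where Z = "- ?c"])
      show "L `` (- ?c) \<subseteq> - ?c"
      proof
        fix z assume "z \<in> L `` (- ?c)"
        then obtain y where y: "y \<notin> ?c" "(y, z) \<in> L" by blast
        then have "(z, y) \<in> L" using sym by (meson symD)
        then show "z \<in> - ?c" using y(1) by (auto intro: rtrancl_into_rtrancl)
      qed
      show "(y, z) \<in> L \<longleftrightarrow> (y, z) \<in> ?M" if "y \<in> - ?c" for y z using that by auto
    qed (use x in simp)
    then show ?thesis by simp
  qed
  have cls: "?rL `` {x} \<in> {?rL `` {p}, ?rL `` {q}} \<longleftrightarrow> x \<in> ?c" for x
    using sym0 tr0 by blast
  have "X // ?rM = insert ?c (X // ?rL - {?rL `` {p}, ?rL `` {q}})"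
  proof (intro set_eqI iffI)
    fix S assume "S \<in> X // ?rM"
    then obtain x where "x \<in> X" "S = ?rM `` {x}" by (auto elim: quotientE)
    then show "S \<in> insert ?c (X // ?rL - {?rL `` {p}, ?rL `` {q}})"
      using inside[of x] outside[of x] cls[of x] by (cases "x \<in> ?c") (auto intro: quotientI)
  next
    fix S assume "S \<in> insert ?c (X // ?rL - {?rL `` {p}, ?rL `` {q}})"
    then consider "S = ?c" | "S \<in> X // ?rL" "S \<notin> {?rL `` {p}, ?rL `` {q}}" by blast
    then show "S \<in> X // ?rM"
    proof cases
      case 1
      have "?rM `` {p} = ?c" by (rule inside) simp
      then show ?thesis using 1 quotientI[OF p, of ?rM] by simp
    next
      case 2
      then obtain x where x: "x \<in> X" "S = ?rL `` {x}" by (auto elim: quotientE)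
      then have "x \<notin> ?c" using 2 cls[of x] by simp
      then show ?thesis using x outside[of x] quotientI[of x X ?rM] by simp
    qed
  qed
  moreover have "?c \<notin> X // ?rL"
  proof
    assume "?c \<in> X // ?rL"
    then obtain x where "?c = ?rL `` {x}" by (auto elim: quotientE)
    then have "(x, p) \<in> ?rL" "(x, q) \<in> ?rL" by blast+
    then show False using pq sym0 tr0 by blast
  qed
  moreover have "?rL `` {p} \<noteq> ?rL `` {q}" using pq by blast
  moreover have "finite (X // ?rL)" using fin by (simp add: quotient_def)
  moreover have "{?rL `` {p}, ?rL `` {q}} \<subseteq> X // ?rL" using p q by (auto intro: quotientI)
  \<comment> \<open>This bound keeps the natural-number subtraction in
    \<open>card_Diff_subset\<close> from truncating.\<close>
  moreover from this have "card {?rL `` {p}, ?rL `` {q}} \<le> card (X // ?rL)"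
    by (rule card_mono[rotated]) fact
  ultimately show ?thesis by (simp add: card_Diff_subset)
qed

text \<open>\<open>D\<close> marks the points whose \<open>\<mu>\<close>-rung is cut; the
  \<open>\<nu>\<close>-rungs are always kept. For fixed-point-free involutions on a finite set and
  empty \<open>D\<close> the components are cycles in which the two kinds alternate.\<close>

definition rungs :: "('a \<Rightarrow> 'a) \<Rightarrow> ('a \<Rightarrow> 'a) \<Rightarrow> 'a set \<Rightarrow> ('a \<times> 'a) set" where
  "rungs \<mu> \<nu> D = {(x, y). x \<notin> D \<and> y = \<mu> x \<or> y = \<nu> x}"

text \<open>
  The rungs form disjoint cycles; cutting the cycle through \<open>p\<close> at the rung from \<open>p\<close> to \<open>\<mu> p\<close>
  leaves a path. Otherwise \<open>\<nu>\<close> would pair off the component \<open>K\<close> of \<open>p\<close>, and \<open>\<mu>\<close> would pair off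
  \<open>K - {p}\<close>.
\<close>

lemma rungs_cut:
  assumes "finite Z" and "p \<in> Z" and D: "D \<inter> Z = {p, \<mu> p}"
    and \<mu>: "\<And>x. x \<in> Z \<Longrightarrow> \<mu> x \<in> Z \<and> \<mu> (\<mu> x) = x \<and> \<mu> x \<noteq> x"
    and \<nu>: "\<And>x. x \<in> Z \<Longrightarrow> \<nu> x \<in> Z \<and> \<nu> (\<nu> x) = x \<and> \<nu> x \<noteq> x"
  shows "(p, \<mu> p) \<in> (rungs \<mu> \<nu> D)\<^sup>*"
proof (rule ccontr)
  let ?K = "(rungs \<mu> \<nu> D)\<^sup>* `` {p}"
  assume np: "(p, \<mu> p) \<notin> (rungs \<mu> \<nu> D)\<^sup>*"
  have "rungs \<mu> \<nu> D `` Z \<subseteq> Z" using \<mu> \<nu> by (auto simp: rungs_def)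
  then have K: "?K \<subseteq> Z" using \<open>p \<in> Z\<close> by (rule rtrancl_Image_closed)
  then have fin: "finite ?K" using \<open>finite Z\<close> finite_subset by blast
  have "even (card ?K)"
  proof (rule even_card_involution[OF fin, of \<nu>])
    fix x assume x: "x \<in> ?K"
    have "(x, \<nu> x) \<in> rungs \<mu> \<nu> D" by (simp add: rungs_def)
    then have "\<nu> x \<in> ?K" using x by (auto intro: rtrancl_into_rtrancl)
    then show "\<nu> x \<in> ?K \<and> \<nu> (\<nu> x) = x \<and> \<nu> x \<noteq> x" using \<nu> x K by blast
  qed
  moreover have "even (card (?K - {p}))"
  proof (rule even_card_involution[of _ \<mu>])
    fix x assume x: "x \<in> ?K - {p}"
    then have xZ: "x \<in> Z" using K by blast
    \<comment> \<open>The only cut points in \<open>Z\<close> are \<open>p\<close>, which has been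
      removed, and \<open>\<mu> p\<close>, which is unreachable by \<open>np\<close>; hence the
      \<open>\<mu>\<close>-rung at \<open>x\<close> survives.\<close>
    have "x \<noteq> \<mu> p" using x np by auto
    then have "x \<notin> D" using D xZ x by auto
    then have "(x, \<mu> x) \<in> rungs \<mu> \<nu> D" by (simp add: rungs_def)
    then have "\<mu> x \<in> ?K" using x by (auto intro: rtrancl_into_rtrancl)
    moreover have "\<mu> x \<noteq> p" using \<open>x \<noteq> \<mu> p\<close> \<mu>[OF xZ] by auto
    ultimately show "\<mu> x \<in> ?K - {p} \<and> \<mu> (\<mu> x) = x \<and> \<mu> x \<noteq> x" using \<mu>[OF xZ] by blast
  qed (use fin in simp)
  moreover have "p \<in> ?K" by simp
  then have "card ?K = Suc (card (?K - {p}))" using fin by (metis card.remove)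
  ultimately show False by (metis even_Suc)
qed

section \<open>Strands of a ribbon surface with twisted edges\<close>

text \<open>
  The flags \<open>(a, False)\<close> and \<open>(a, True)\<close> are the beginning and the end of the left side of \<open>a\<close>;
  \<open>\<phi>\<close> is the facial permutation and \<open>T\<close> the set of arcs of the twisted edges.
\<close>

definition corner :: "('b \<Rightarrow> 'b) \<Rightarrow> 'b \<times> bool \<Rightarrow> 'b \<times> bool" where
  "corner \<phi> x = (if snd x then (\<phi> (fst x), False) else (inv \<phi> (fst x), True))"

text \<open>The flag \<open>(arev a, False)\<close> is the right side of \<open>a\<close> at its
  head, so a strand that runs along a twisted edge arrives on the opposite side.\<close>

definition side :: "('b \<Rightarrow> 'b) \<Rightarrow> 'b set \<Rightarrow> 'b \<times> bool \<Rightarrow> 'b \<times> bool" where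
  "side arev T x = (if fst x \<in> T then (arev (fst x), snd x) else (fst x, \<not> snd x))"

text \<open>For a facial permutation \<open>\<phi>\<close> these are the boundary components of the
  ribbon surface in which the edges of \<open>T\<close> are twisted.\<close>

definition strands :: "'b set \<Rightarrow> ('b \<Rightarrow> 'b) \<Rightarrow> ('b \<Rightarrow> 'b) \<Rightarrow> 'b set \<Rightarrow> ('b \<times> bool) set set" where
  "strands \<Omega> \<phi> arev T = (\<Omega> \<times> UNIV) // (rungs (corner \<phi>) (side arev T) {})\<^sup>*"

lemma corner_simps [simp]:
  "corner \<phi> (a, True) = (\<phi> a, False)" "corner \<phi> (a, False) = (inv \<phi> a, True)"
  by (simp_all add: corner_def)

lemma side_simps [simp]:
  "a \<in> T \<Longrightarrow> side arev T (a, e) = (arev a, e)" "a \<notin> T \<Longrightarrow> side arev T (a, e) = (a, \<not> e)"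
  by (simp_all add: side_def)

lemma corner_corner [simp]: "bij \<phi> \<Longrightarrow> corner \<phi> (corner \<phi> x) = x"
  by (cases x; cases "snd x") (auto simp: bij_is_inj bij_is_surj surj_f_inv_f)

lemma corner_neq: "corner \<phi> x \<noteq> x"
  by (auto simp: corner_def prod_eq_iff)

text \<open>Neither corners nor sides lead from \<open>Y\<close> to its complement or back, so each
  strand stays in one part and sees only the twists of that part.\<close>

lemma card_strands_split:
  assumes fin: "finite \<Omega>" and Y: "Y \<subseteq> \<Omega>" and bij: "bij \<phi>"
    and \<phi>Y: "\<phi> ` Y = Y" and \<phi>Z: "\<phi> ` (\<Omega> - Y) = \<Omega> - Y"
    and TY: "arev ` (T \<inter> Y) \<subseteq> Y" and TZ: "arev ` (T - Y) \<subseteq> \<Omega> - Y"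
  shows "card (strands \<Omega> \<phi> arev T)
    = card (strands Y \<phi> arev (T \<inter> Y)) + card (strands (\<Omega> - Y) \<phi> arev (T - Y))"
proof -
  let ?L = "\<lambda>T. rungs (corner \<phi>) (side arev T) {}"
  have inv: "inv \<phi> ` W = W" if "\<phi> ` W = W" for W
    using that bij by (metis bij_is_inj image_inv_f_f)
  have invW: "inv \<phi> a \<in> W" if "\<phi> ` W = W" "a \<in> W" for W a
    using inv[OF that(1)] that(2) by blast
  have \<phi>W: "\<phi> a \<in> W" if "\<phi> ` W = W" "a \<in> W" for W a
    using that by blast
  have clY: "?L T `` (Y \<times> UNIV) \<subseteq> Y \<times> UNIV"
    using invW[OF \<phi>Y] \<phi>W[OF \<phi>Y] TY by (auto simp: rungs_def corner_def side_def)
  have clZ: "?L T `` ((\<Omega> - Y) \<times> UNIV) \<subseteq> (\<Omega> - Y) \<times> UNIV"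
  proof
    fix y assume "y \<in> ?L T `` ((\<Omega> - Y) \<times> UNIV)"
    then obtain x where "x \<in> (\<Omega> - Y) \<times> UNIV" and y: "y = corner \<phi> x \<or> y = side arev T x"
      unfolding rungs_def by blast
    then have x: "fst x \<in> \<Omega> - Y" by auto
    have "fst y \<in> \<Omega> - Y"
      using y invW[OF \<phi>Z x] \<phi>W[OF \<phi>Z x] TZ x
      by (cases x; cases "snd x"; cases "fst x \<in> T") (auto simp: image_subset_iff)
    then show "y \<in> (\<Omega> - Y) \<times> UNIV" by (simp add: mem_Times_iff)
  qed
  have eqY: "(Y \<times> UNIV) // (?L T)\<^sup>* = strands Y \<phi> arev (T \<inter> Y)"
  proof -
    have "(?L T)\<^sup>* `` {x} = (?L (T \<inter> Y))\<^sup>* `` {x}" if "x \<in> Y \<times> UNIV" for x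
      by (rule rtrancl_Image_cong[OF clY _ that]) (auto simp: rungs_def side_def)
    then show ?thesis by (simp add: strands_def quotient_def)
  qed
  have eqZ: "((\<Omega> - Y) \<times> UNIV) // (?L T)\<^sup>* = strands (\<Omega> - Y) \<phi> arev (T - Y)"
  proof -
    have "(?L T)\<^sup>* `` {x} = (?L (T - Y))\<^sup>* `` {x}" if "x \<in> (\<Omega> - Y) \<times> UNIV" for x
      by (rule rtrancl_Image_cong[OF clZ _ that]) (auto simp: rungs_def side_def)
    then show ?thesis by (simp add: strands_def quotient_def)
  qed
  have "\<Omega> \<times> (UNIV :: bool set) = Y \<times> UNIV \<union> (\<Omega> - Y) \<times> UNIV" using Y by auto
  then have "strands \<Omega> \<phi> arev T = strands Y \<phi> arev (T \<inter> Y) \<union> strands (\<Omega> - Y) \<phi> arev (T - Y)"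
    unfolding eqY[symmetric] eqZ[symmetric] by (simp add: strands_def quotient_def)
  moreover have "strands Y \<phi> arev (T \<inter> Y) \<inter> strands (\<Omega> - Y) \<phi> arev (T - Y) = {}"
  proof -
    \<comment> \<open>A common strand would lie in two disjoint sets of flags and thus be
      empty.\<close>
    have "S \<subseteq> Y \<times> UNIV \<and> S \<noteq> {}" if "S \<in> (Y \<times> UNIV) // (?L T)\<^sup>*" for S
      using that rtrancl_Image_closed[OF clY] by (fastforce elim!: quotientE)
    moreover have "S \<subseteq> (\<Omega> - Y) \<times> UNIV" if "S \<in> ((\<Omega> - Y) \<times> UNIV) // (?L T)\<^sup>*" for S
      using that rtrancl_Image_closed[OF clZ] by (fastforce elim!: quotientE)
    ultimately show ?thesis unfolding eqY eqZ by blast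
  qed
  moreover have "finite Y" using fin Y finite_subset by blast
  then have "finite (strands Y \<phi> arev (T \<inter> Y))" "finite (strands (\<Omega> - Y) \<phi> arev (T - Y))"
    using fin by (auto simp: strands_def quotient_def)
  ultimately show ?thesis by (simp add: card_Un_disjoint)
qed

text \<open>The two permutations differ in two corner rungs. Those of \<open>\<phi>'\<close> lie one
  in each part, and deleting them opens one cycle in each part to a path. The rungs of
  \<open>\<phi>\<close> join the ends of these paths crosswise, giving one cycle instead of two.
  Twists respect the parts, and each path must end at the two flags cut in its part, so they cannot
  alter this.\<close>

lemma card_strands_merge:
  fixes arev :: "'b \<Rightarrow> 'b"
  assumes fin: "finite \<Omega>" and Y: "Y \<subseteq> \<Omega>" and bij: "bij \<phi>"
    and l1: "l1 \<in> Y" and l2: "l2 \<in> \<Omega> - Y"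
    and \<phi>': "\<phi>' = \<phi> \<circ> transpose l1 l2"
    and \<phi>Y: "\<phi>' ` Y = Y" and \<phi>Z: "\<phi>' ` (\<Omega> - Y) = \<Omega> - Y"
    and arev: "\<And>a. arev (arev a) = a" "\<And>a. a \<in> T \<Longrightarrow> arev a \<noteq> a"
    and TY: "arev ` (T \<inter> Y) \<subseteq> T \<inter> Y" and TZ: "arev ` (T - Y) \<subseteq> T - Y" and T: "T \<subseteq> \<Omega>"
  shows "card (strands \<Omega> \<phi> arev T) + 1 = card (strands \<Omega> \<phi>' arev T)"
proof -
  \<comment> \<open>The corner of \<open>\<phi>'\<close> pairs \<open>p1\<close> with
    \<open>q1\<close> and \<open>p2\<close> with \<open>q2\<close>; that of \<open>\<phi>\<close>
    pairs \<open>p1\<close> with \<open>q2\<close> and \<open>p2\<close> with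
    \<open>q1\<close>.\<close>
  define p1 p2 where p: "p1 = (l1, True)" "p2 = (l2, True)"
  define q1 q2 where q: "q1 = (\<phi> l2, False)" "q2 = (\<phi> l1, False)"
  define \<mu> \<mu>' \<nu> where m: "\<mu> = corner \<phi>" "\<mu>' = corner \<phi>'" "\<nu> = side arev T"
  define D where "D = {p1, q1, p2, q2}"
  \<comment> \<open>\<open>L0\<close> is the common part of both systems: all rungs except the
    corner rungs at the four flags of \<open>D\<close>.\<close>
  define L0 where "L0 = rungs \<mu>' \<nu> D"
  have bij': "bij \<phi>'" unfolding \<phi>' using bij by (simp add: bij_comp)
  have inv': "inv \<phi>' a = transpose l1 l2 (inv \<phi> a)" for a
  proof -
    have "\<phi>' (transpose l1 l2 (inv \<phi> a)) = a"
      unfolding \<phi>' using bij by (simp add: bij_is_surj surj_f_inv_f)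
    then show ?thesis using bij' by (metis bij_inv_eq_iff)
  qed
  have inv_eq: "inv \<phi> a = b \<longleftrightarrow> a = \<phi> b" for a b using bij by (metis bij_inv_eq_iff)
  have \<mu>'D: "\<mu>' p1 = q1" "\<mu>' q1 = p1" "\<mu>' p2 = q2" "\<mu>' q2 = p2"
    using bij_is_inj[OF bij] by (auto simp: m p q \<phi>' inv'[unfolded \<phi>'])
  have \<mu>D: "\<mu> p1 = q2" "\<mu> q1 = p2" "\<mu> p2 = q1" "\<mu> q2 = p1"
    using bij_is_inj[OF bij] by (auto simp: m p q)
  have agree: "\<mu> x = \<mu>' x" if "x \<notin> D" for x
  proof (cases x)
    case (Pair a e)
    then show ?thesis using that
      by (cases e) (auto simp: m p q D_def \<phi>' inv'[unfolded \<phi>'] transpose_def inv_eq)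
  qed
  have \<mu>'2: "\<mu>' (\<mu>' x) = x" for x using bij' by (simp add: m)
  have \<nu>2: "\<nu> (\<nu> x) = x" for x
  proof -
    have "arev a \<in> T \<longleftrightarrow> a \<in> T" for a using TY TZ arev(1) by (metis Diff_iff Int_iff image_subset_iff)
    then show ?thesis by (cases x; cases "fst x \<in> T") (auto simp: m arev(1))
  qed
  have \<nu>1: "\<nu> x \<noteq> x" for x
    using arev(2) by (cases x; cases "fst x \<in> T") (auto simp: m)
  have decomp: "rungs \<kappa> \<nu> {} = rungs \<kappa> \<nu> D \<union> (\<lambda>x. (x, \<kappa> x)) ` D" for \<kappa>
    by (auto simp: rungs_def)
  have eq': "rungs \<mu>' \<nu> {} = L0 \<union> {(p1, q1), (q1, p1), (p2, q2), (q2, p2)}"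
    unfolding decomp L0_def by (simp add: D_def \<mu>'D)
  have "rungs \<mu> \<nu> D = L0"
    unfolding L0_def rungs_def by (intro Collect_cong) (auto simp: agree)
  then have eq: "rungs \<mu> \<nu> {} = L0 \<union> {(p1, q2), (q1, p2), (p2, q1), (q2, p1)}"
    unfolding decomp by (simp add: D_def \<mu>D)
  have "sym L0"
  proof (rule symI)
    fix x y assume "(x, y) \<in> L0"
    then consider "x \<notin> D" "y = \<mu>' x" | "y = \<nu> x" by (auto simp: L0_def rungs_def)
    then show "(y, x) \<in> L0"
    proof cases
      case 1
      then have "y \<notin> D" using \<mu>'D \<mu>'2[of x] by (auto simp: D_def)
      then show ?thesis using 1 \<mu>'2 by (simp add: L0_def rungs_def)
    qed (simp add: \<nu>2 L0_def rungs_def)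
  qed
  then have sym0: "(x, y) \<in> L0\<^sup>* \<Longrightarrow> (y, x) \<in> L0\<^sup>*" for x y
    by (meson sym_rtrancl symD)
  have inv: "inv \<phi>' a \<in> W" if "\<phi>' ` W = W" "a \<in> W" for W a
    using that bij' by (metis bij_is_inj image_eqI image_inv_f_f)
  have \<mu>W: "\<mu>' x \<in> W \<times> UNIV" if "\<phi>' ` W = W" "x \<in> W \<times> UNIV" for W x
    using that inv[OF that(1)] by (cases x; cases "snd x") (auto simp: m)
  have \<nu>Y: "\<nu> x \<in> Y \<times> UNIV" if "x \<in> Y \<times> UNIV" for x
    using that TY by (cases x; cases "fst x \<in> T") (auto simp: m)
  have \<nu>Z: "\<nu> x \<in> (\<Omega> - Y) \<times> UNIV" if "x \<in> (\<Omega> - Y) \<times> UNIV" for x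
    using that TZ T by (cases x; cases "fst x \<in> T") (auto simp: m)
  have pY: "p1 \<in> Y \<times> UNIV" "p2 \<in> (\<Omega> - Y) \<times> UNIV" using l1 l2 by (auto simp: p)
  have qY: "q1 \<in> Y \<times> UNIV" "q2 \<in> (\<Omega> - Y) \<times> UNIV"
    using \<mu>W[OF \<phi>Y pY(1)] \<mu>W[OF \<phi>Z pY(2)] \<mu>'D by auto
  have "finite Y" using fin Y finite_subset by blast
  \<comment> \<open>\<open>Y \<times> UNIV\<close> contains just one cut rung, so
    \<open>rungs_cut\<close> applies: the remaining path still joins its ends.\<close>
  have 1: "(p1, q1) \<in> L0\<^sup>*"
  proof -
    have "(p1, \<mu>' p1) \<in> (rungs \<mu>' \<nu> D)\<^sup>*"
    proof (rule rungs_cut[where Z = "Y \<times> UNIV"])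
      show "D \<inter> Y \<times> UNIV = {p1, \<mu>' p1}" using pY qY by (auto simp: D_def \<mu>'D)
      show "\<mu>' x \<in> Y \<times> UNIV \<and> \<mu>' (\<mu>' x) = x \<and> \<mu>' x \<noteq> x" if "x \<in> Y \<times> UNIV" for x
        using \<mu>W[OF \<phi>Y that] \<mu>'2 corner_neq by (simp add: m)
      show "\<nu> x \<in> Y \<times> UNIV \<and> \<nu> (\<nu> x) = x \<and> \<nu> x \<noteq> x" if "x \<in> Y \<times> UNIV" for x
        using \<nu>Y[OF that] \<nu>2 \<nu>1 by simp
    qed (use pY \<open>finite Y\<close> in auto)
    then show ?thesis by (simp add: L0_def \<mu>'D)
  qed
  have 2: "(p2, q2) \<in> L0\<^sup>*"
  proof -
    have "(p2, \<mu>' p2) \<in> (rungs \<mu>' \<nu> D)\<^sup>*"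
    proof (rule rungs_cut[where Z = "(\<Omega> - Y) \<times> UNIV"])
      show "D \<inter> (\<Omega> - Y) \<times> UNIV = {p2, \<mu>' p2}" using pY qY by (auto simp: D_def \<mu>'D)
      show "\<mu>' x \<in> (\<Omega> - Y) \<times> UNIV \<and> \<mu>' (\<mu>' x) = x \<and> \<mu>' x \<noteq> x" if "x \<in> (\<Omega> - Y) \<times> UNIV" for x
        using \<mu>W[OF \<phi>Z that] \<mu>'2 corner_neq by (simp add: m)
      show "\<nu> x \<in> (\<Omega> - Y) \<times> UNIV \<and> \<nu> (\<nu> x) = x \<and> \<nu> x \<noteq> x" if "x \<in> (\<Omega> - Y) \<times> UNIV" for x
        using \<nu>Z[OF that] \<nu>2 \<nu>1 by simp
    qed (use pY fin in auto)
    then show ?thesis by (simp add: L0_def \<mu>'D)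
  qed
  have r': "(rungs \<mu>' \<nu> {})\<^sup>* = L0\<^sup>*"
    by (rule rtrancl_subset) (use 1 2 sym0 in \<open>auto simp: eq'\<close>)
  \<comment> \<open>As \<open>p2\<close> and \<open>q2\<close>, and likewise \<open>p1\<close> and
    \<open>q1\<close>, are already connected in \<open>L0\<close>, the two crossing rungs have the
    effect of a single link from \<open>p1\<close> to \<open>p2\<close>.\<close>
  let ?J = "L0 \<union> {(p1, p2), (p2, p1)}"
  have r: "(rungs \<mu> \<nu> {})\<^sup>* = ?J\<^sup>*"
  proof
    have sub: "(x, y) \<in> L0\<^sup>* \<Longrightarrow> (x, y) \<in> ?J\<^sup>*" for x y using rtrancl_mono[of L0 ?J] by blast
    have J: "(p1, p2) \<in> ?J\<^sup>*" "(p2, p1) \<in> ?J\<^sup>*" by auto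
    have "rungs \<mu> \<nu> {} \<subseteq> ?J\<^sup>*"
      unfolding eq using sub[OF 1] sub[OF 2] sub[OF sym0[OF 1]] sub[OF sym0[OF 2]] J
      by (auto intro: rtrancl_trans)
    then show "(rungs \<mu> \<nu> {})\<^sup>* \<subseteq> ?J\<^sup>*" by (rule rtrancl_subset_rtrancl)
    let ?R = "rungs \<mu> \<nu> {}"
    have sub: "(x, y) \<in> L0\<^sup>* \<Longrightarrow> (x, y) \<in> ?R\<^sup>*" for x y
      using rtrancl_mono[of L0 ?R] unfolding eq by blast
    have J: "(p1, q2) \<in> ?R\<^sup>*" "(q2, p1) \<in> ?R\<^sup>*" unfolding eq by auto
    have "(p1, p2) \<in> ?R\<^sup>*" "(p2, p1) \<in> ?R\<^sup>*"
      using sub[OF 2] sub[OF sym0[OF 2]] J by (auto intro: rtrancl_trans)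
    moreover have "L0 \<subseteq> ?R\<^sup>*" unfolding eq by blast
    ultimately have "?J \<subseteq> ?R\<^sup>*" by blast
    then show "?J\<^sup>* \<subseteq> ?R\<^sup>*" by (rule rtrancl_subset_rtrancl)
  qed
  have "(p1, p2) \<notin> L0\<^sup>*"
  proof -
    have "L0 `` (Y \<times> UNIV) \<subseteq> Y \<times> UNIV"
    proof
      fix y assume "y \<in> L0 `` (Y \<times> UNIV)"
      then obtain x where x: "x \<in> Y \<times> UNIV" "y = \<mu>' x \<or> y = \<nu> x"
        unfolding L0_def rungs_def by blast
      then show "y \<in> Y \<times> UNIV" using \<mu>W[OF \<phi>Y x(1)] \<nu>Y[OF x(1)] by metis
    qed
    then have "L0\<^sup>* `` {p1} \<subseteq> Y \<times> UNIV" using pY(1) by (rule rtrancl_Image_closed)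
    then show ?thesis using l2 by (auto simp: p)
  qed
  then have "card ((\<Omega> \<times> UNIV) // ?J\<^sup>*) + 1 = card ((\<Omega> \<times> UNIV) // L0\<^sup>*)"
    using fin l1 l2 Y by (intro card_quotient_join[OF \<open>sym L0\<close>]) (simp_all add: p subset_iff)
  then show ?thesis unfolding strands_def m(1)[symmetric] m(2)[symmetric] m(3)[symmetric] r r' .
qed

text \<open>\<open>\<phi>\<close> leaves \<open>Y\<close> only at \<open>l1\<close> and enters it
  only at \<open>l2\<close>; exchanging the successors of these two makes \<open>Y\<close>
  invariant. After the exchange the count is a term in \<open>T \<inter> Y\<close> plus a term in
  \<open>T - Y\<close>, and the exchange always costs one strand. Comparing the four choices of
  \<open>T\<close> cancels everything else.\<close>

lemma card_strands_Un:
  fixes arev :: "'b \<Rightarrow> 'b"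
  assumes fin: "finite \<Omega>" and Y: "Y \<subseteq> \<Omega>" and \<phi>: "\<phi> permutes \<Omega>"
    and l1: "l1 \<in> Y" "\<phi> l1 \<notin> Y" and l2: "l2 \<in> \<Omega> - Y" "\<phi> l2 \<in> Y"
    and other: "\<And>x. x \<in> \<Omega> - {l1, l2} \<Longrightarrow> \<phi> x \<in> Y \<longleftrightarrow> x \<in> Y"
    and arev: "\<And>a. arev (arev a) = a" "\<And>a. a \<in> \<Omega> \<Longrightarrow> arev a \<noteq> a"
    and B: "B \<subseteq> Y" "arev ` B \<subseteq> B" and C: "C \<subseteq> \<Omega> - Y" "arev ` C \<subseteq> C"
  shows "card (strands \<Omega> \<phi> arev (B \<union> C)) + card (strands \<Omega> \<phi> arev {})
    = card (strands \<Omega> \<phi> arev B) + card (strands \<Omega> \<phi> arev C)"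
proof -
  define \<phi>' where "\<phi>' = \<phi> \<circ> transpose l1 l2"
  have \<phi>'p: "\<phi>' permutes \<Omega>"
    unfolding \<phi>'_def by (rule permutes_compose[OF _ \<phi>]) (use l1 l2 Y in \<open>auto intro: permutes_swap_id\<close>)
  have \<phi>'Y: "\<phi>' x \<in> Y \<longleftrightarrow> x \<in> Y" if "x \<in> \<Omega>" for x
    using that other[of x] l1 l2 by (auto simp: \<phi>'_def transpose_def)
  have bij: "bij \<phi>" "bij \<phi>'" using \<phi> \<phi>'p by (auto intro: permutes_bij)
  have img: "\<phi>' ` Y = Y"
  proof (rule endo_inj_surj)
    show "finite Y" using fin Y finite_subset by blast
    show "\<phi>' ` Y \<subseteq> Y" using \<phi>'Y Y by auto
    show "inj_on \<phi>' Y" using bij bij_is_inj inj_on_subset by blast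
  qed
  have img2: "\<phi>' ` (\<Omega> - Y) = \<Omega> - Y"
    using img \<phi>'p permutes_image[OF \<phi>'p] by (simp add: image_set_diff bij bij_is_inj)
  let ?a = "\<lambda>T. card (strands Y \<phi>' arev T)" and ?b = "\<lambda>T. card (strands (\<Omega> - Y) \<phi>' arev T)"
  have key: "card (strands \<Omega> \<phi> arev T) + 1 = ?a (T \<inter> Y) + ?b (T - Y)"
    if T: "T \<subseteq> \<Omega>" "arev ` (T \<inter> Y) \<subseteq> T \<inter> Y" "arev ` (T - Y) \<subseteq> T - Y" for T
  proof -
    have "card (strands \<Omega> \<phi> arev T) + 1 = card (strands \<Omega> \<phi>' arev T)"
      by (rule card_strands_merge[OF fin Y bij(1) l1(1) l2(1) \<phi>'_def img img2])
        (use T arev in auto)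
    also have "\<dots> = ?a (T \<inter> Y) + ?b (T - Y)"
      by (rule card_strands_split[OF fin Y bij(2) img img2]) (use T in auto)
    finally show ?thesis .
  qed
  have sets: "(B \<union> C) \<inter> Y = B" "(B \<union> C) - Y = C" "B \<inter> Y = B" "B - Y = {}" "C \<inter> Y = {}" "C - Y = C"
    using B C by auto
  have "card (strands \<Omega> \<phi> arev (B \<union> C)) + 1 = ?a B + ?b C"
    using key[of "B \<union> C"] B C Y unfolding sets by blast
  moreover have "card (strands \<Omega> \<phi> arev B) + 1 = ?a B + ?b {}"
    using key[of B] B Y unfolding sets by blast
  moreover have "card (strands \<Omega> \<phi> arev C) + 1 = ?a {} + ?b C"
    using key[of C] C Y unfolding sets by blast
  moreover have "card (strands \<Omega> \<phi> arev {}) + 1 = ?a {} + ?b {}"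
    using key[of "{}"] by auto
  ultimately show ?thesis by linarith
qed

section \<open>Cutting a facial walk into two intervals\<close>

text \<open>Each step of the inherited rotation is a stretch of \<open>\<rho>\<close> whose inner
  arcs lie outside \<open>A\<close>. Concatenating these stretches turns a run of the inherited
  rotation into an interval of \<open>\<rho>\<close>.\<close>

lemma consecutive_in_interval:
  assumes perm: "permutation \<rho>" and B: "B \<noteq> {}" "B \<subseteq> A"
    and cons: "consecutive_in (inherited_rotation \<rho> A) B"
  obtains a n where "{(\<rho> ^^ j) a | j. j < n} \<inter> A = B"
proof -
  let ?\<tau> = "inherited_rotation \<rho> A"
  obtain a m where am: "B = {(?\<tau> ^^ j) a | j. j < m}"
    using cons by (auto simp: consecutive_in_def)
  with B have "0 < m" by force
  then have "(?\<tau> ^^ 0) a \<in> B" unfolding am by blast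
  then have "a \<in> A" using B by auto
  \<comment> \<open>A permutation of finite support brings \<open>x\<close> back to itself, so the
    \<open>LEAST\<close> in \<open>inherited_rotation\<close> is attained.\<close>
  have step: "\<exists>t>0. (\<rho> ^^ t) x \<in> A \<and> ?\<tau> x = (\<rho> ^^ t) x \<and> (\<forall>s. 0 < s \<and> s < t \<longrightarrow> (\<rho> ^^ s) x \<notin> A)"
    if "x \<in> A" for x
  proof -
    let ?P = "\<lambda>n. 0 < n \<and> (\<rho> ^^ n) x \<in> A"
    have "x \<in> orbit \<rho> x" using perm by (rule permutation_self_in_orbit)
    then have "\<exists>n. ?P n" using that unfolding orbit_altdef by force
    then have "?P (Least ?P)" by (rule LeastI_ex)
    then show ?thesis using not_less_Least[of _ ?P]
      by (intro exI[of _ "Least ?P"]) (auto simp: inherited_rotation_def)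
  qed
  \<comment> \<open>The induction also records that the interval stops just before the next arc of
    the run and that this arc lies in \<open>A\<close>, so that the next stretch can be
    attached.\<close>
  have "(?\<tau> ^^ m) a \<in> A \<and> (\<exists>n. {(\<rho> ^^ j) a | j. j < n} \<inter> A = {(?\<tau> ^^ j) a | j. j < m}
      \<and> (\<rho> ^^ n) a = (?\<tau> ^^ m) a)" for m
  proof (induction m)
    case 0
    then show ?case using \<open>a \<in> A\<close> by (auto intro: exI[of _ 0])
  next
    case (Suc m)
    let ?x = "(?\<tau> ^^ m) a"
    obtain n where n: "{(\<rho> ^^ j) a | j. j < n} \<inter> A = {(?\<tau> ^^ j) a | j. j < m}"
      "(\<rho> ^^ n) a = ?x" and x: "?x \<in> A" using Suc by blast
    obtain t where t: "0 < t" "(\<rho> ^^ t) ?x \<in> A" "?\<tau> ?x = (\<rho> ^^ t) ?x"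
      "\<And>s. 0 < s \<Longrightarrow> s < t \<Longrightarrow> (\<rho> ^^ s) ?x \<notin> A"
      using step[OF x] by blast
    have shift: "(\<rho> ^^ (n + s)) a = (\<rho> ^^ s) ?x" for s
      by (simp add: add.commute[of n] funpow_add n(2))
    have "{(\<rho> ^^ j) a | j. j < n + t} = {(\<rho> ^^ j) a | j. j < n} \<union> {(\<rho> ^^ s) ?x | s. s < t}"
    proof (intro set_eqI iffI)
      fix y assume "y \<in> {(\<rho> ^^ j) a | j. j < n + t}"
      then obtain j where j: "j < n + t" "y = (\<rho> ^^ j) a" by blast
      show "y \<in> {(\<rho> ^^ j) a | j. j < n} \<union> {(\<rho> ^^ s) ?x | s. s < t}"
      proof (cases "j < n")
        case False
        then have "y = (\<rho> ^^ (j - n)) ?x" "j - n < t" using j shift[of "j - n"] by auto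
        then show ?thesis by blast
      qed (use j in blast)
    next
      fix y assume "y \<in> {(\<rho> ^^ j) a | j. j < n} \<union> {(\<rho> ^^ s) ?x | s. s < t}"
      then consider j where "j < n" "y = (\<rho> ^^ j) a" | s where "s < t" "y = (\<rho> ^^ (n + s)) a"
        using shift by auto
      then show "y \<in> {(\<rho> ^^ j) a | j. j < n + t}"
        by cases (use trans_less_add1 nat_add_left_cancel_less in blast)+
    qed
    \<comment> \<open>By minimality of \<open>t\<close> the new stretch meets \<open>A\<close> only
      in its first arc.\<close>
    moreover have "{(\<rho> ^^ s) ?x | s. s < t} \<inter> A = {?x}"
    proof -
      have "(\<rho> ^^ s) ?x = ?x" if "s < t" "(\<rho> ^^ s) ?x \<in> A" for s
        using t(4)[of s] that by (cases "s = 0") auto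
      moreover have "?x \<in> {(\<rho> ^^ s) ?x | s. s < t}"
        using t(1) by (intro CollectI exI[of _ 0]) simp
      ultimately show ?thesis using x by blast
    qed
    moreover have "{(?\<tau> ^^ j) a | j. j < Suc m} = insert ?x {(?\<tau> ^^ j) a | j. j < m}"
      by (auto simp: less_Suc_eq)
    ultimately have "{(\<rho> ^^ j) a | j. j < n + t} \<inter> A = {(?\<tau> ^^ j) a | j. j < Suc m}"
      by (simp only: Int_Un_distrib2 n(1) Un_insert_right Un_empty_right)
    moreover have "(\<rho> ^^ (n + t)) a = (?\<tau> ^^ Suc m) a" using shift t(3) by simp
    moreover have "(?\<tau> ^^ Suc m) a \<in> A" using t(2,3) by simp
    ultimately show ?case by blast
  qed
  from this[of m] obtain n where "{(\<rho> ^^ j) a | j. j < n} \<inter> A = B" unfolding am by blast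
  then show ?thesis by (rule that)
qed

lemma permutation_orbit_eq:
  assumes "permutation g" and "z \<in> orbit g y"
  shows "orbit g z = orbit g y"
  using orbit_cyclic_eq3[OF cyclic_on_orbit'[OF assms(1)] assms(2)] .

text \<open>Let \<open>Y\<close> consist of the interval on \<open>f\<close> and of all other faces
  meeting \<open>B\<close>. By \<open>BC\<close> no face other than \<open>f\<close> meets both
  \<open>B\<close> and \<open>C\<close>, so \<open>Y\<close> contains \<open>B\<close> and avoids
  \<open>C\<close>, and \<open>\<phi>\<close> crosses the border of \<open>Y\<close> only at the two
  ends of the interval.\<close>

lemma card_strands_Un_interval:
  fixes arev :: "'b \<Rightarrow> 'b"
  assumes fin: "finite \<Omega>" and \<phi>: "\<phi> permutes \<Omega>"
    and arev: "\<And>a. arev (arev a) = a" "\<And>a. a \<in> \<Omega> \<Longrightarrow> arev a \<noteq> a"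
    and B: "B \<subseteq> \<Omega>" "arev ` B \<subseteq> B" and C: "C \<subseteq> \<Omega>" "arev ` C \<subseteq> C" and disj: "B \<inter> C = {}"
    and f: "f = orbit \<phi> x"
    and BC: "\<And>b c. b \<in> B \<Longrightarrow> c \<in> C \<Longrightarrow> orbit \<phi> b = orbit \<phi> c \<Longrightarrow> orbit \<phi> b = f"
    and interval: "{(\<phi> ^^ j) a | j. j < n} \<inter> (B \<union> C) = B \<inter> f"
    and Bf: "B \<inter> f \<noteq> {}" and Cf: "C \<inter> f \<noteq> {}"
  shows "card (strands \<Omega> \<phi> arev (B \<union> C)) + card (strands \<Omega> \<phi> arev {})
    = card (strands \<Omega> \<phi> arev B) + card (strands \<Omega> \<phi> arev C)"
proof -
  define I where "I = {(\<phi> ^^ j) a | j. j < n}"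
  have perm: "permutation \<phi>" using fin \<phi> permutation_permutes by blast
  have bij: "bij \<phi>" using \<phi> by (rule permutes_bij)
  have self: "y \<in> orbit \<phi> y" for y using perm by (rule permutation_self_in_orbit)
  have orb: "orbit \<phi> z = orbit \<phi> y" if "z \<in> orbit \<phi> y" for y z
    using perm that by (rule permutation_orbit_eq)
  have step: "orbit \<phi> (\<phi> y) = orbit \<phi> y" for y using perm by (rule permutation_orbit_step)
  obtain b where b: "b \<in> B" "b \<in> f" using Bf by blast
  then have "b \<in> I" using interval by (auto simp: I_def)
  then obtain j where j: "b = (\<phi> ^^ j) a" "j < n" by (auto simp: I_def)
  have "b \<in> orbit \<phi> a" unfolding j using self by (rule funpow_in_orbit)
  then have f_a: "f = orbit \<phi> a" using orb b f by metis
  have fb: "f = orbit \<phi> b" using orb b f by metis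
  have "b \<in> \<Omega>" using b B by blast
  have f\<Omega>: "f \<subseteq> \<Omega>" unfolding fb using permutes_orbit_subset[OF \<phi> \<open>b \<in> \<Omega>\<close>] .
  have If: "I \<subseteq> f" unfolding I_def f_a using funpow_in_orbit[OF self] by blast
  have "a \<in> f" using self f_a by simp
  have "0 < n" using j by simp
  have aI: "a \<in> I" unfolding I_def using \<open>0 < n\<close> by (auto intro: exI[of _ 0])
  have "C \<inter> I = {}" using interval disj unfolding I_def by blast
  with Cf If have "I \<noteq> f" by blast
  \<comment> \<open>\<open>l1\<close> is the last arc of the interval and \<open>l2\<close> the
    predecessor of its first arc.\<close>
  define l1 l2 where "l1 = (\<phi> ^^ (n - 1)) a" and "l2 = inv \<phi> a"
  have l1I: "l1 \<in> I" unfolding I_def l1_def using \<open>0 < n\<close> by auto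
  have \<phi>l2: "\<phi> l2 = a" unfolding l2_def using bij by (simp add: bij_is_surj surj_f_inv_f)
  have stay: "\<phi> y \<in> I" if "y \<in> I" "y \<noteq> l1" for y
  proof -
    obtain i where i: "y = (\<phi> ^^ i) a" "i < n" using \<open>y \<in> I\<close> by (auto simp: I_def)
    with that have "Suc i < n" unfolding l1_def by (metis Suc_lessI diff_Suc_1)
    then show ?thesis unfolding I_def using i by (auto intro!: exI[of _ "Suc i"])
  qed
  have enter: "y \<in> I" if "\<phi> y \<in> I" "y \<noteq> l2" for y
  proof -
    obtain i where i: "\<phi> y = (\<phi> ^^ i) a" "i < n" using \<open>\<phi> y \<in> I\<close> by (auto simp: I_def)
    have "i \<noteq> 0"
    proof
      assume "i = 0"
      then have "\<phi> y = \<phi> l2" using i \<phi>l2 by simp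
      then show False using that(2) bij by (simp add: bij_is_inj inj_eq)
    qed
    then obtain i' where i': "i = Suc i'" by (cases i) auto
    then have "y = (\<phi> ^^ i') a" using i bij by (simp add: bij_is_inj inj_eq)
    then show ?thesis unfolding I_def using i i' by auto
  qed
  have all: "f \<subseteq> I" if "\<And>y. y \<in> I \<Longrightarrow> \<phi> y \<in> I"
  proof
    fix y assume "y \<in> f"
    then have "y \<in> orbit \<phi> a" by (simp add: f_a)
    then show "y \<in> I" by induction (use aI that in auto)
  qed
  have \<phi>l1: "\<phi> l1 \<notin> I" using all stay \<open>I \<noteq> f\<close> If by blast
  \<comment> \<open>Otherwise the walk would close up within the interval, which would then be all
    of \<open>f\<close>, although \<open>C\<close> meets \<open>f\<close> outside it.\<close>
  have l2I: "l2 \<notin> I"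
  proof
    assume "l2 \<in> I"
    then obtain i where i: "l2 = (\<phi> ^^ i) a" "i < n" by (auto simp: I_def)
    then have "(\<phi> ^^ Suc i) a = a" using \<phi>l2 by simp
    then have "f = {(\<phi> ^^ m) a | m. m < Suc i}" unfolding f_a by (rule orbit_altdef_bounded) simp
    then have "f \<subseteq> I" unfolding I_def using i by auto
    then show False using \<open>I \<noteq> f\<close> If by blast
  qed
  have "l2 \<in> f" using \<phi>l2 step[of l2] self f_a by metis
  define Y where "Y = I \<union> {y \<in> \<Omega>. orbit \<phi> y \<noteq> f \<and> orbit \<phi> y \<inter> B \<noteq> {}}"
  have orbf: "orbit \<phi> y = f" if "y \<in> f" for y using orb that f by metis
  have memf: "y \<in> Y \<longleftrightarrow> y \<in> I" if "y \<in> f" for y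
    unfolding Y_def using orbf[OF that] by auto
  have memnf: "y \<in> Y \<longleftrightarrow> y \<in> \<Omega> \<and> orbit \<phi> y \<inter> B \<noteq> {}" if "y \<notin> f" for y
    unfolding Y_def using If that self[of y] by auto
  have \<phi>f: "\<phi> y \<in> f \<longleftrightarrow> y \<in> f" for y using orbf step self by metis
  show ?thesis
  proof (rule card_strands_Un[OF fin _ \<phi>, of Y l1 l2])
    show "Y \<subseteq> \<Omega>" using If f\<Omega> unfolding Y_def by blast
    show "l1 \<in> Y" using l1I unfolding Y_def by simp
    have "l1 \<in> f" using l1I If by blast
    then show "\<phi> l1 \<notin> Y" using \<phi>l1 memf[of "\<phi> l1"] \<phi>f by blast
    show "l2 \<in> \<Omega> - Y" using l2I memf[OF \<open>l2 \<in> f\<close>] f\<Omega> \<open>l2 \<in> f\<close> by blast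
    show "\<phi> l2 \<in> Y" using aI \<phi>l2 unfolding Y_def by simp
    show "\<phi> y \<in> Y \<longleftrightarrow> y \<in> Y" if "y \<in> \<Omega> - {l1, l2}" for y
    proof (cases "y \<in> f")
      case True
      then show ?thesis using memf[of y] memf[of "\<phi> y"] \<phi>f[of y] that stay enter by blast
    next
      case False
      moreover have "\<phi> y \<in> \<Omega>" using that permutes_in_image[OF \<phi>] by simp
      ultimately show ?thesis
        using memnf[of y] memnf[of "\<phi> y"] \<phi>f[of y] step[of y] that by simp
    qed
    show "B \<subseteq> Y"
    proof
      fix y assume y: "y \<in> B"
      show "y \<in> Y"
      proof (cases "y \<in> f")
        case True
        then show ?thesis using y interval unfolding Y_def I_def by blast
      next
        case False
        then show ?thesis using y memnf[of y] self[of y] B by blast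
      qed
    qed
    show "C \<subseteq> \<Omega> - Y"
    proof
      fix y assume y: "y \<in> C"
      have "y \<notin> Y"
      proof (cases "y \<in> f")
        case True
        then show ?thesis using y memf[of y] \<open>C \<inter> I = {}\<close> by blast
      next
        case False
        have "orbit \<phi> y \<inter> B = {}"
        proof (rule ccontr)
          assume "orbit \<phi> y \<inter> B \<noteq> {}"
          then obtain z where z: "z \<in> orbit \<phi> y" "z \<in> B" by blast
          then have "orbit \<phi> y = f" using BC[OF z(2) y] orb[OF z(1)] by simp
          then show False using False self[of y] by simp
        qed
        then show ?thesis using False memnf by blast
      qed
      then show "y \<in> \<Omega> - Y" using y C by blast
    qed
  qed (use arev B C in auto)
qed

section \<open>Flipping vertices of a rotation system\<close>

lemma sym_rtrancl_Image_eq_iff: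
  assumes "sym L"
  shows "L\<^sup>* `` {x} = L\<^sup>* `` {y} \<longleftrightarrow> (x, y) \<in> L\<^sup>*"
proof -
  have "equiv UNIV (L\<^sup>*)"
    using refl_rtrancl[of L] sym_rtrancl[OF assms] trans_rtrancl[of L] by (simp add: equiv_def)
  then show ?thesis by (simp add: eq_equiv_class_iff)
qed

text \<open>Both images are quotients of \<open>S\<close> by the same equivalence. It is used to
  match faces with strands.\<close>

lemma card_image_cong_eq:
  assumes "\<And>x y. x \<in> S \<Longrightarrow> y \<in> S \<Longrightarrow> g x = g y \<longleftrightarrow> h x = h y"
  shows "card (g ` S) = card (h ` S)"
proof -
  have "bij_betw (\<lambda>u. h (inv_into S g u)) (g ` S) (h ` S)"
  proof (rule bij_betw_imageI)
    have *: "h (inv_into S g (g x)) = h x" if "x \<in> S" for x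
      using assms[of "inv_into S g (g x)" x] that by (simp add: f_inv_into_f inv_into_into)
    show "inj_on (\<lambda>u. h (inv_into S g u)) (g ` S)"
      by (rule inj_onI) (auto simp: * assms)
    show "(\<lambda>u. h (inv_into S g u)) ` g ` S = h ` S"
      by (simp add: image_image * cong: image_cong_simp)
  qed
  then show ?thesis by (rule bij_betw_same_card)
qed

text \<open>In a rotation system \<open>\<pi>\<close> preserves tails, so at each single vertex
  \<open>inv \<pi>\<close> is the mirror image of the local rotation.\<close>

definition flip :: "('a, 'b) pre_digraph \<Rightarrow> ('b \<Rightarrow> 'b) \<Rightarrow> 'a set \<Rightarrow> 'b \<Rightarrow> 'b" where
  "flip G \<pi> U a = (if a \<in> arcs G \<and> tail G a \<in> U then inv \<pi> a else \<pi> a)"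

definition cut_arcs :: "('a, 'b) pre_digraph \<Rightarrow> 'a set \<Rightarrow> 'b set" where
  "cut_arcs G U = {a \<in> arcs G. (tail G a \<in> U) \<noteq> (head G a \<in> U)}"

locale rotation_graph = fin_digraph G + bidirected_digraph G arev
  for G :: "('a, 'b) pre_digraph" and arev :: "'b \<Rightarrow> 'b" +
  fixes \<pi> :: "'b \<Rightarrow> 'b"
  assumes rotation: "rotation_system G \<pi>"
begin

lemma permutes: "\<pi> permutes arcs G"
  using rotation by (simp add: rotation_system_def)

lemma cyclic: "a \<in> arcs G \<Longrightarrow> cyclic_on \<pi> (out_arcs G (tail G a))"
  using rotation unfolding rotation_system_def by (metis empty_iff in_out_arcs_conv tail_in_verts)

lemma bij: "bij \<pi>"
  using permutes by (rule permutes_bij)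

lemma perm: "permutation \<pi>"
  using permutes finite_arcs permutation_permutes by blast

lemma in_arcs: "\<pi> a \<in> arcs G \<longleftrightarrow> a \<in> arcs G"
  using permutes by (rule permutes_in_image)

lemma inv_in_arcs: "inv \<pi> a \<in> arcs G \<longleftrightarrow> a \<in> arcs G"
  using permutes_inv[OF permutes] by (rule permutes_in_image)

lemma tail_rotation: "a \<in> arcs G \<Longrightarrow> tail G (\<pi> a) = tail G a"
  using cyclic_on_inI[OF cyclic] by simp

lemma rotation_inv: "\<pi> (inv \<pi> a) = a"
  using bij by (simp add: bij_is_surj surj_f_inv_f)

lemma inv_rotation: "inv \<pi> (\<pi> a) = a"
  using bij by (simp add: bij_is_inj)

lemma tail_inv_rotation: "a \<in> arcs G \<Longrightarrow> tail G (inv \<pi> a) = tail G a"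
  using tail_rotation[of "inv \<pi> a"] by (simp add: inv_in_arcs rotation_inv)

lemma orbit_rotation: "a \<in> arcs G \<Longrightarrow> orbit \<pi> a = out_arcs G (tail G a)"
  using orbit_cyclic_eq3[OF cyclic] by simp

lemma flip_in_arcs: "flip G \<pi> U a \<in> arcs G \<longleftrightarrow> a \<in> arcs G"
  by (simp add: flip_def in_arcs inv_in_arcs)

lemma tail_flip: "a \<in> arcs G \<Longrightarrow> tail G (flip G \<pi> U a) = tail G a"
  by (simp add: flip_def tail_rotation tail_inv_rotation)

lemma flip_permutes: "flip G \<pi> U permutes arcs G"
proof (rule bij_imp_permutes)
  have "inj_on (flip G \<pi> U) (arcs G)"
  proof (rule inj_onI)
    fix a b assume ab: "a \<in> arcs G" "b \<in> arcs G" "flip G \<pi> U a = flip G \<pi> U b"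
    \<comment> \<open>With equal tails both arcs fall into the same branch of \<open>flip\<close>,
      and each branch is injective.\<close>
    then have "tail G a = tail G b" using tail_flip by metis
    then show "a = b" using ab by (auto simp: flip_def split: if_splits) (metis rotation_inv inv_rotation)+
  qed
  moreover from this have "flip G \<pi> U ` arcs G = arcs G"
    by (intro endo_inj_surj) (auto simp: flip_in_arcs)
  ultimately show "bij_betw (flip G \<pi> U) (arcs G) (arcs G)"
    by (simp add: bij_betw_def)
  show "flip G \<pi> U a = a" if "a \<notin> arcs G" for a
    using that permutes by (simp add: flip_def permutes_def)
qed

lemma rotation_system_flip: "rotation_system G (flip G \<pi> U)"
  unfolding rotation_system_def
proof (intro conjI ballI impI flip_permutes)
  fix v assume v: "v \<in> verts G" "out_arcs G v \<noteq> {}"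
  then obtain a where "a \<in> out_arcs G v" by blast
  then have a: "a \<in> arcs G" "tail G a = v" by auto
  have "cyclic_on (inv \<pi>) (out_arcs G v)"
    using a orbit_rotation[OF a(1)] orbit_inv_eq[OF perm, of a] unfolding cyclic_on_def
    by (intro bexI[of _ a]) auto
  moreover have "cyclic_on \<pi> (out_arcs G v)" using cyclic[OF a(1)] a(2) by simp
  moreover have "cyclic_on (flip G \<pi> U) (out_arcs G v)
      = cyclic_on (if v \<in> U then inv \<pi> else \<pi>) (out_arcs G v)"
    by (rule cyclic_cong) (auto simp: flip_def)
  ultimately show "cyclic_on (flip G \<pi> U) (out_arcs G v)" by simp
qed

text \<open>
  \<open>start a\<close> and \<open>finish a\<close> are the flags at the two ends of the left side of \<open>a\<close> in the flipped
  embedding: at a flipped vertex, this side is the right side of \<open>a\<close> in the base embedding.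
\<close>

lemma card_faces_flip:
  "card (faces G arev (flip G \<pi> U)) = card (strands (arcs G) (\<pi> \<circ> arev) arev (cut_arcs G U))"
proof -
  define \<psi> where "\<psi> = flip G \<pi> U \<circ> arev"
  define start where "start a = (if tail G a \<in> U then (arev a, True) else (a, False))" for a
  define finish where "finish a = (if head G a \<in> U then (arev a, False) else (a, True))" for a
  let ?c = "corner (\<pi> \<circ> arev)" and ?s = "side arev (cut_arcs G U)"
  let ?L = "rungs ?c ?s {}"
  have \<psi>: "\<psi> permutes arcs G"
    unfolding \<psi>_def by (rule permutes_compose[OF arev_permutes_arcs flip_permutes])
  then have perm\<psi>: "permutation \<psi>" using finite_arcs permutation_permutes by blast
  have bij\<phi>: "bij (\<pi> \<circ> arev)" using bij bij_arev by (simp add: bij_comp)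
  have inv\<phi>: "inv (\<pi> \<circ> arev) a = arev (inv \<pi> a)" for a
  proof -
    have "(\<pi> \<circ> arev) (arev (inv \<pi> a)) = a" by (simp add: rotation_inv)
    then show ?thesis using bij\<phi> by (metis bij_inv_eq_iff)
  qed
  \<comment> \<open>\<open>start a\<close> and \<open>finish a\<close> lie on different sides of
    \<open>a\<close> exactly when one end of \<open>a\<close> is flipped, that is, when its edge is
    twisted.\<close>
  have s1: "?s (start a) = finish a" "?s (finish a) = start a" if "a \<in> arcs G" for a
    using that by (auto simp: start_def finish_def side_def cut_arcs_def)
  \<comment> \<open>At a flipped head the corner of the base embedding is traversed backwards, which
    is the \<open>inv\<close> branch of \<open>corner\<close>.\<close>
  have c1: "?c (finish a) = start (\<psi> a)" if "a \<in> arcs G" for a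
    using that tail_flip[of "arev a" U]
    by (auto simp: start_def finish_def \<psi>_def inv\<phi> flip_def)
  have c2: "?c (start (\<psi> a)) = finish a" if "a \<in> arcs G" for a
    using c1[OF that] corner_corner[OF bij\<phi>] by metis
  have sym: "sym ?L"
  proof (rule symI)
    fix x y assume "(x, y) \<in> ?L"
    then have "y = ?c x \<or> y = ?s x" by (simp add: rungs_def)
    moreover have "?s (?s x) = x"
      by (cases x; cases "fst x \<in> cut_arcs G U") (auto simp: side_def cut_arcs_def)
    ultimately have "x = ?c y \<or> x = ?s y" using corner_corner[OF bij\<phi>, of x] by auto
    then show "(y, x) \<in> ?L" by (simp add: rungs_def)
  qed
  have sf: "(start a, finish a) \<in> ?L\<^sup>*" if "a \<in> arcs G" for a
    using s1[OF that] by (intro r_into_rtrancl) (simp add: rungs_def)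
  have fs: "(finish a, start (\<psi> a)) \<in> ?L\<^sup>*" if "a \<in> arcs G" for a
    using c1[OF that] by (intro r_into_rtrancl) (simp add: rungs_def)
  have forward: "(start a, start b) \<in> ?L\<^sup>*" if "a \<in> arcs G" "b \<in> orbit \<psi> a" for a b
    using that(2)
  proof induction
    case base
    show ?case using sf[OF that(1)] fs[OF that(1)] by (rule rtrancl_trans)
  next
    case (step b)
    then have b: "b \<in> arcs G" using permutes_orbit_subset[OF \<psi> that(1)] by blast
    show ?case using step.IH sf[OF b] fs[OF b] by (meson rtrancl_trans)
  qed
  have backward: "b \<in> orbit \<psi> a"
    if ab: "a \<in> arcs G" "b \<in> arcs G" "(start a, start b) \<in> ?L\<^sup>*" for a b
  proof -
    let ?O = "orbit \<psi> a"
    have O: "?O \<subseteq> arcs G" using permutes_orbit_subset[OF \<psi> ab(1)] .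
    have self: "a \<in> ?O" using perm\<psi> by (rule permutation_self_in_orbit)
    \<comment> \<open>The corner at \<open>start c\<close> leads back to the finish of the arc
      before \<open>c\<close> on the face, so closure of the flag set needs predecessors inside the
      orbit.\<close>
    have pred: "\<exists>d\<in>?O. c = \<psi> d" if "c \<in> ?O" for c
      using that self by cases auto
    have "?L `` (start ` ?O \<union> finish ` ?O) \<subseteq> start ` ?O \<union> finish ` ?O"
    proof
      fix y assume "y \<in> ?L `` (start ` ?O \<union> finish ` ?O)"
      then obtain x where "x \<in> start ` ?O \<union> finish ` ?O" and y: "y = ?c x \<or> y = ?s x"
        unfolding rungs_def by blast
      then consider c where "c \<in> ?O" "x = start c" | c where "c \<in> ?O" "x = finish c" by blast
      then show "y \<in> start ` ?O \<union> finish ` ?O"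
      proof cases
        case (1 c)
        obtain d where "d \<in> ?O" "c = \<psi> d" using pred[OF 1(1)] by blast
        then have "?c x = finish d" "?s x = finish c" using c2[of d] s1[of c] O 1 by blast+
        then show ?thesis using y 1 \<open>d \<in> ?O\<close> by auto
      next
        case (2 c)
        then have "?c x = start (\<psi> c)" "?s x = start c" using c1[of c] s1[of c] O by blast+
        then show ?thesis using y 2 orbit.step[OF 2(1)] by auto
      qed
    qed
    then have "?L\<^sup>* `` {start a} \<subseteq> start ` ?O \<union> finish ` ?O"
      by (rule rtrancl_Image_closed) (use self in simp)
    then have "start b \<in> start ` ?O \<union> finish ` ?O" using ab(3) by blast
    \<comment> \<open>Equality would make \<open>b\<close> and \<open>c\<close> mutually reverse,
      with the vertex \<open>tail G b = head G c\<close> both flipped and not flipped.\<close>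
    moreover have "start b \<noteq> finish c" if "c \<in> arcs G" for c
      using that ab(2) by (auto simp: start_def finish_def split: if_splits)
    moreover have "b = c" if "start b = start c" for c
      using that by (auto simp: start_def arev_eq_iff split: if_splits)
    ultimately show ?thesis using O by blast
  qed
  \<comment> \<open>Every flag is the start or the finish of an arc, and both ends of an arc lie on
    one strand; hence the starts represent all strands.\<close>
  have "strands (arcs G) (\<pi> \<circ> arev) arev (cut_arcs G U) = (\<lambda>a. ?L\<^sup>* `` {start a}) ` arcs G"
  proof -
    have flag: "\<exists>a\<in>arcs G. x = start a \<or> x = finish a" if x: "x \<in> arcs G \<times> UNIV" for x
    proof (cases x)
      case (Pair a e)
      then have a: "a \<in> arcs G" using x by simp
      have "x \<in> {start a, finish a, start (arev a), finish (arev a)}"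
        using a Pair by (cases e) (auto simp: start_def finish_def)
      then show ?thesis using a arev_in_arcs[OF a] by blast
    qed
    have in_flags: "start a \<in> arcs G \<times> UNIV" if "a \<in> arcs G" for a
      using that by (auto simp: start_def)
    have eqcl: "?L\<^sup>* `` {finish a} = ?L\<^sup>* `` {start a}" if "a \<in> arcs G" for a
      using sf[OF that] sym_rtrancl_Image_eq_iff[OF sym] by blast
    show ?thesis
    proof (intro set_eqI iffI)
      fix S assume "S \<in> strands (arcs G) (\<pi> \<circ> arev) arev (cut_arcs G U)"
      then obtain x where x: "x \<in> arcs G \<times> UNIV" "S = ?L\<^sup>* `` {x}"
        by (auto simp: strands_def elim: quotientE)
      obtain a where a: "a \<in> arcs G" "x = start a \<or> x = finish a" using flag[OF x(1)] by blast
      then have "S = ?L\<^sup>* `` {start a}" using x(2) eqcl[OF a(1)] by metis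
      then show "S \<in> (\<lambda>a. ?L\<^sup>* `` {start a}) ` arcs G" using a(1) by (rule image_eqI)
    next
      fix S assume "S \<in> (\<lambda>a. ?L\<^sup>* `` {start a}) ` arcs G"
      then show "S \<in> strands (arcs G) (\<pi> \<circ> arev) arev (cut_arcs G U)"
        unfolding strands_def using quotientI[OF in_flags] by auto
    qed
  qed
  moreover have "card (orbit \<psi> ` arcs G) = card ((\<lambda>a. ?L\<^sup>* `` {start a}) ` arcs G)"
  proof (rule card_image_cong_eq)
    fix a b assume ab: "a \<in> arcs G" "b \<in> arcs G"
    have "orbit \<psi> a = orbit \<psi> b \<longleftrightarrow> b \<in> orbit \<psi> a"
      using permutation_self_in_orbit[OF perm\<psi>, of b]
        permutation_orbit_eq[OF perm\<psi>, of b a] by auto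
    also have "\<dots> \<longleftrightarrow> (start a, start b) \<in> ?L\<^sup>*" using forward backward ab by blast
    also have "\<dots> \<longleftrightarrow> ?L\<^sup>* `` {start a} = ?L\<^sup>* `` {start b}"
      using sym_rtrancl_Image_eq_iff[OF sym] by blast
    finally show "orbit \<psi> a = orbit \<psi> b \<longleftrightarrow> ?L\<^sup>* `` {start a} = ?L\<^sup>* `` {start b}" .
  qed
  moreover have "faces G arev (flip G \<pi> U) = orbit \<psi> ` arcs G"
    by (simp add: faces_def face_of_def \<psi>_def)
  ultimately show ?thesis by simp
qed

end

section \<open>Rotations at vertices of degree three\<close>

lemma cyclic_on_card_3:
  assumes cyc: "cyclic_on p S" and card: "card S = 3" and x: "x \<in> S"
  shows "S = {x, p x, p (p x)}" "p (p (p x)) = x" "distinct [x, p x, p (p x)]"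
proof -
  have S: "S = orbit p x" using orbit_cyclic_eq3[OF cyc x] by simp
  then have self: "x \<in> orbit p x" using x by simp
  let ?d = "funpow_dist1 p x x"
  have im: "S = (\<lambda>n. (p ^^ n) x) ` {0..<?d}" unfolding S by (rule orbit_conv_funpow_dist1[OF self])
  have inj: "inj_on (\<lambda>n. (p ^^ n) x) {0..<?d}" by (rule inj_on_funpow_dist1[OF self])
  have d: "?d = 3" using card card_image[OF inj] im by simp
  have "(p ^^ ?d) x = x" using self by (rule funpow_dist1_prop)
  then show "p (p (p x)) = x" unfolding d by (simp add: numeral_3_eq_3)
  have 3: "{0..<3::nat} = {0, 1, 2}" by auto
  show *: "S = {x, p x, p (p x)}" using im unfolding d 3 by (simp add: numeral_2_eq_2)
  show "distinct [x, p x, p (p x)]"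
    using card unfolding * by (auto simp: card_insert_if split: if_splits)
qed

text \<open>Three points admit only two cyclic orders, inverse to each other, so a disagreement at
  one point decides \<open>q\<close> everywhere on \<open>S\<close>.\<close>

lemma cyclic_on_card_3_inverse:
  assumes p: "cyclic_on p S" and q: "cyclic_on q S" and card: "card S = 3"
    and x: "x \<in> S" "p x \<noteq> q x" and y: "y \<in> S"
  shows "p (q y) = y"
proof -
  note P = cyclic_on_card_3[OF p card x(1)] and Q = cyclic_on_card_3[OF q card x(1)]
  have "q x \<in> S" using cyclic_on_inI[OF q x(1)] .
  then have qx: "q x = p (p x)" using P Q x(2) by auto
  have "q (q x) \<in> S" using cyclic_on_inI[OF q \<open>q x \<in> S\<close>] .
  then have qqx: "q (q x) = p x" using P Q qx by auto
  show ?thesis using y P Q qx qqx by (smt (verit) insert_iff empty_iff)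
qed

context rotation_graph
begin

text \<open>Otherwise \<open>\<pi>\<close> would have order two on a cycle of length three.
  Consequently a flipped vertex is really unstable.\<close>

lemma inv_rotation_neq:
  assumes cubic: "cubic G" and a: "a \<in> arcs G"
  shows "inv \<pi> a \<noteq> \<pi> a"
proof
  assume eq: "inv \<pi> a = \<pi> a"
  have card: "card (out_arcs G (tail G a)) = 3"
    using cubic a by (simp add: cubic_def out_degree_def)
  have "distinct [a, \<pi> a, \<pi> (\<pi> a)]"
    by (rule cyclic_on_card_3(3)[OF cyclic[OF a] card]) (use a in simp)
  then show False using rotation_inv[of a] eq by simp
qed

lemma unstable_vertex_flip:
  assumes cubic: "cubic G"
  shows "unstable_vertex G \<pi> (flip G \<pi> U) v \<longleftrightarrow> v \<in> verts G \<and> v \<in> U"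
proof (cases "v \<in> verts G")
  case True
  then have "card (out_arcs G v) = 3" using cubic by (simp add: cubic_def out_degree_def)
  then have "out_arcs G v \<noteq> {}" by auto
  then show ?thesis
    using True inv_rotation_neq[OF cubic] by (auto simp: unstable_vertex_def flip_def)
qed (simp add: unstable_vertex_def)

lemma unstable_arcs_flip:
  assumes "cubic G"
  shows "unstable_arcs G \<pi> (flip G \<pi> U) = cut_arcs G U"
  by (auto simp: unstable_arcs_def cut_arcs_def unstable_vertex_flip[OF assms])

lemma rotation_system_eq_flip:
  assumes cubic: "cubic G" and \<rho>: "rotation_system G \<rho>"
  shows "\<rho> = flip G \<pi> {v. unstable_vertex G \<pi> \<rho> v}"
proof
  interpret \<rho>: rotation_graph G arev \<rho> by unfold_locales (rule \<rho>)
  fix a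
  show "\<rho> a = flip G \<pi> {v. unstable_vertex G \<pi> \<rho> v} a"
  proof (cases "a \<in> arcs G")
    case a: True
    show ?thesis
    proof (cases "unstable_vertex G \<pi> \<rho> (tail G a)")
      case True
      then obtain b where b: "b \<in> out_arcs G (tail G a)" "\<pi> b \<noteq> \<rho> b"
        by (auto simp: unstable_vertex_def)
      have card: "card (out_arcs G (tail G a)) = 3"
        using cubic a by (simp add: cubic_def out_degree_def)
      have "\<pi> (\<rho> a) = a"
        by (rule cyclic_on_card_3_inverse[OF cyclic[OF a] \<rho>.cyclic[OF a] card b]) (use a in simp)
      then have "\<rho> a = inv \<pi> a" using inv_rotation by metis
      then show ?thesis using True a by (simp add: flip_def)
    next
      case False
      then have "\<rho> a = \<pi> a" using a by (auto simp: unstable_vertex_def)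
      then show ?thesis using False by (simp add: flip_def)
    qed
  next
    case False
    then have "\<rho> a = a" "\<pi> a = a" using permutes \<rho>.permutes by (simp_all add: permutes_not_in)
    then show ?thesis using False by (simp add: flip_def)
  qed
qed

text \<open>The faces of the dual are the stars \<open>out_arcs G v\<close>. An edge meets the stars
  in \<open>S\<close> once for each of its ends whose star is in \<open>S\<close>; the count is odd
  exactly when one end qualifies and the other does not.\<close>

lemma zero_homologous_cut_arcs:
  assumes "zero_homologous (dual_graph G arev \<pi>) arev (dual_rotation arev \<pi>) H"
  obtains U where "arcs H = cut_arcs G U"
proof -
  have "\<pi> \<circ> arev \<circ> arev = \<pi>" by (simp add: fun_eq_iff)
  then have faces: "faces (dual_graph G arev \<pi>) arev (dual_rotation arev \<pi>)
      = (\<lambda>a. out_arcs G (tail G a)) ` arcs G"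
    by (simp add: faces_def face_of_def dual_rotation_def dual_graph_def orbit_rotation)
  have arcs_dual: "arcs (dual_graph G arev \<pi>) = arcs G" by (simp add: dual_graph_def)
  obtain S where S: "S \<subseteq> (\<lambda>a. out_arcs G (tail G a)) ` arcs G"
    and H: "arcs H = {a \<in> arcs G. odd (\<Sum>B\<in>S. card (B \<inter> {a, arev a}))}"
    using assms unfolding zero_homologous_def faces arcs_dual by blast
  have fin: "finite S" using S by (rule finite_subset) simp
  have sum1: "(\<Sum>B\<in>S. of_bool (a \<in> B)) = (of_bool (out_arcs G (tail G a) \<in> S) :: nat)"
    if a: "a \<in> arcs G" for a
  proof -
    have "(\<Sum>B\<in>S. of_bool (a \<in> B)) = (\<Sum>B\<in>S. if B = out_arcs G (tail G a) then 1 else 0 :: nat)"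
      using S a by (intro sum.cong) auto
    then show ?thesis using fin by simp
  qed
  have "(\<Sum>B\<in>S. card (B \<inter> {a, arev a}))
      = of_bool (out_arcs G (tail G a) \<in> S) + of_bool (out_arcs G (head G a) \<in> S)"
    if a: "a \<in> arcs G" for a
  proof -
    have "card (B \<inter> {a, arev a}) = of_bool (a \<in> B) + of_bool (arev a \<in> B)" for B
      using arev_neq[OF a] by (simp add: Int_insert_right)
    then show ?thesis using sum1[OF a] sum1[OF arev_in_arcs[OF a]] a by (simp add: sum.distrib)
  qed
  then have "arcs H = cut_arcs G {v. out_arcs G v \<in> S}"
    unfolding H cut_arcs_def by (intro Collect_cong) (auto split: if_splits simp: of_bool_def)
  then show ?thesis by (rule that)
qed

section \<open>Facial orbits and subgraphs of the dual\<close>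

lemma perm_face: "permutation (\<pi> \<circ> arev)"
  using permutes_compose[OF arev_permutes_arcs permutes] finite_arcs permutation_permutes by blast

lemma orbit_face_eq:
  assumes "F \<in> faces G arev \<pi>" "a \<in> F"
  shows "orbit (\<pi> \<circ> arev) a = F"
proof -
  obtain x where "F = orbit (\<pi> \<circ> arev) x" using assms(1) by (auto simp: faces_def face_of_def)
  then show ?thesis using assms(2) permutation_orbit_eq[OF perm_face] by simp
qed

lemma tail_dual_subgraph:
  "subgraph H (dual_graph G arev \<pi>) \<Longrightarrow> tail H a = orbit (\<pi> \<circ> arev) a"
  by (auto simp: subgraph_def compatible_def dual_graph_def face_of_def dest: sym)

lemma out_arcs_dual_subgraph:
  assumes H: "subgraph H (dual_graph G arev \<pi>)" and F: "F \<in> faces G arev \<pi>"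
  shows "out_arcs H F = arcs H \<inter> F"
  using orbit_face_eq[OF F] permutation_self_in_orbit[OF perm_face]
  by (auto simp: out_arcs_def tail_dual_subgraph[OF H])

text \<open>By \<open>ne\<close> the subgraph has no isolated vertex, so its vertices are exactly
  the faces containing one of its arcs; its arcs alone therefore determine it within the
  dual.\<close>

lemma unstable_dual_flip:
  assumes cubic: "cubic G" and H: "subgraph H (dual_graph G arev \<pi>)"
    and ne: "\<And>F. F \<in> verts H \<Longrightarrow> out_arcs H F \<noteq> {}" and U: "arcs H = cut_arcs G U"
  shows "unstable_dual G arev \<pi> (flip G \<pi> U) = H"
proof -
  have tail: "tail H = face_of arev \<pi>" "head H = (\<lambda>a. face_of arev \<pi> (arev a))"
    and verts: "verts H \<subseteq> faces G arev \<pi>" and wf: "wf_digraph H"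
    using H by (auto simp: subgraph_def compatible_def dual_graph_def)
  have "unstable_faces G arev \<pi> (flip G \<pi> U) = {F \<in> faces G arev \<pi>. F \<inter> arcs H \<noteq> {}}"
    by (simp add: unstable_faces_def unstable_arcs_flip[OF cubic] U)
  also have "\<dots> = verts H"
  proof (intro set_eqI iffI)
    fix F assume "F \<in> {F \<in> faces G arev \<pi>. F \<inter> arcs H \<noteq> {}}"
    then obtain a where a: "a \<in> arcs H" "a \<in> F" "F \<in> faces G arev \<pi>" by blast
    then have "F = tail H a" using orbit_face_eq by (simp add: tail face_of_def)
    then show "F \<in> verts H" using wf_digraph.tail_in_verts[OF wf a(1)] by simp
  next
    fix F assume F: "F \<in> verts H"
    then show "F \<in> {F \<in> faces G arev \<pi>. F \<inter> arcs H \<noteq> {}}"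
      using ne[OF F] verts out_arcs_dual_subgraph[OF H, of F] by blast
  qed
  finally show ?thesis
    using tail unstable_arcs_flip[OF cubic, of U] U
    by (simp add: unstable_dual_def dual_graph_def)
qed

end

section \<open>Additivity of the genus change by induction on the number of summands\<close>

theorem theorem4p5:
  fixes G :: "('a, 'b) pre_digraph"
    and arev :: "'b \<Rightarrow> 'b"
    and \<pi>0 \<pi> :: "'b \<Rightarrow> 'b"
    and f :: "'b set"
    and k :: nat
    and H :: "nat \<Rightarrow> ('b set, 'b) pre_digraph"
  assumes "fin_digraph G" and "bidirected_digraph G arev" and "connected G" and "cubic G"
    and "rotation_system G \<pi>0" and "rotation_system G \<pi>"
    and "cut_vertex (unstable_dual G arev \<pi>0 \<pi>) f"
    and "\<forall>i\<in>{1..k}. undirected_subgraph arev (H i) (dual_graph G arev \<pi>0)"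
    and "\<forall>i\<in>{1..k}. \<forall>F\<in>verts (H i). out_arcs (H i) F \<noteq> {}"
    and "\<forall>i\<in>{1..k}. zero_homologous (dual_graph G arev \<pi>0) arev (dual_rotation arev \<pi>0) (H i)"
    and "unstable_dual G arev \<pi>0 \<pi> = pre_digraph.Union (dual_graph G arev \<pi>0) (H ` {1..k})"
    and "\<forall>i\<in>{1..k}. \<forall>j\<in>{1..k}. i < j \<longrightarrow>
           verts (H i) \<inter> verts (H j) = {f} \<and> arcs (H i) \<inter> arcs (H j) = {}"
    and "\<forall>i\<in>{1..k}. consecutive_in (unstable_rotation G arev \<pi>0 \<pi>) (out_arcs (H i) f)"
  shows "\<exists>\<rho> :: nat \<Rightarrow> 'b \<Rightarrow> 'b.
           (\<forall>i\<in>{1..k}. rotation_system G (\<rho> i) \<and> unstable_dual G arev \<pi>0 (\<rho> i) = H i) \<and>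
           genus_diff G arev \<pi>0 \<pi> = (\<Sum>i=1..k. genus_diff G arev \<pi>0 (\<rho> i))"
proof -
  interpret fin_digraph G by fact
  interpret bidirected_digraph G arev by fact
  interpret rotation_graph G arev \<pi>0 by unfold_locales fact
  let ?\<phi> = "\<pi>0 \<circ> arev" and ?A = "\<lambda>i. arcs (H i)"
  define W where "W = {v. unstable_vertex G \<pi>0 \<pi> v}"
  define A where "A = unstable_arcs G \<pi>0 \<pi>"
  define N where "N T = card (strands (arcs G) ?\<phi> arev T)" for T
  have \<phi>: "?\<phi> permutes arcs G" by (rule permutes_compose[OF arev_permutes_arcs permutes])
  have sub: "subgraph (H i) (dual_graph G arev \<pi>0)" "arev ` ?A i \<subseteq> ?A i"
    and ne: "F \<in> verts (H i) \<Longrightarrow> out_arcs (H i) F \<noteq> {}"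
    if "i \<in> {1..k}" for i F
    using assms(8,9) that by (auto simp: undirected_subgraph_def)
  have A_arcs: "?A i \<subseteq> arcs G" and verts_faces: "verts (H i) \<subseteq> faces G arev \<pi>0"
    if "i \<in> {1..k}" for i
    using sub(1)[OF that] by (auto simp: subgraph_def dual_graph_def)
  have A_Un: "A = (\<Union>i\<in>{1..k}. ?A i)"
    using arg_cong[OF assms(11), of arcs] by (simp add: unstable_dual_def A_def pre_digraph.Union_def)
  have face_in_verts: "orbit ?\<phi> a \<in> verts (H i)" if "i \<in> {1..k}" "a \<in> ?A i" for i a
  proof -
    have "wf_digraph (H i)" using sub(1)[OF that(1)] by (simp add: subgraph_def)
    then show ?thesis
      using wf_digraph.tail_in_verts[OF _ that(2)] tail_dual_subgraph[OF sub(1)[OF that(1)]] by simp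
  qed
  have meet: "verts (H i) \<inter> verts (H j) = {f}" "?A i \<inter> ?A j = {}"
    if "i \<in> {1..k}" "j \<in> {1..k}" "i \<noteq> j" for i j
  proof -
    have "verts (H i) \<inter> verts (H j) = {f} \<and> ?A i \<inter> ?A j = {}"
    proof (cases "i < j")
      case False
      then have "verts (H j) \<inter> verts (H i) = {f} \<and> ?A j \<inter> ?A i = {}"
        using assms(12) that by (metis linorder_neqE_nat)
      then show ?thesis by (simp only: Int_commute)
    qed (use assms(12) that in blast)
    then show "verts (H i) \<inter> verts (H j) = {f}" "?A i \<inter> ?A j = {}" by blast+
  qed
  have "\<forall>i\<in>{1..k}. \<exists>U. ?A i = cut_arcs G U"
    using assms(10) zero_homologous_cut_arcs by metis
  then obtain U where U: "\<And>i. i \<in> {1..k} \<Longrightarrow> ?A i = cut_arcs G (U i)" by metis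
  \<comment> \<open>The witness flips one side of the cut formed by the edges of
    \<open>H i\<close>.\<close>
  define \<rho> where "\<rho> i = flip G \<pi>0 (U i)" for i
  have \<pi>: "\<pi> = flip G \<pi>0 W"
    unfolding W_def using assms(4,6) by (rule rotation_system_eq_flip)
  have cut_W: "cut_arcs G W = A"
    unfolding A_def by (subst \<pi>) (rule unstable_arcs_flip[OF assms(4), symmetric])
  \<comment> \<open>Vertices and edges are the same in both embeddings, so the genus grows by half
    the loss of faces, and the faces are counted by strands.\<close>
  have diff: "genus_diff G arev \<pi>0 (flip G \<pi>0 V) = (of_nat (N {}) - of_nat (N (cut_arcs G V))) / 2"
    for V
  proof -
    have "flip G \<pi>0 {} = \<pi>0" "cut_arcs G {} = {}" by (auto simp: flip_def cut_arcs_def fun_eq_iff)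
    then have "card (faces G arev \<pi>0) = N {}" using card_faces_flip[of "{}"] by (simp add: N_def)
    then show ?thesis
      using card_faces_flip[of V] by (simp add: genus_diff_def genus_def euler_char_def N_def field_simps)
  qed
  \<comment> \<open>Summands are split off one at a time: the next one plays the role of
    \<open>B\<close>, the union of the earlier ones that of \<open>C\<close>.\<close>
  have sum: "of_nat (N {}) - of_nat (N (\<Union>i\<in>{1..n}. ?A i))
      = (\<Sum>i=1..n. of_nat (N {}) - (of_nat (N (?A i)) :: rat))" if "n \<le> k" for n
    using that
  proof (induction n)
    case (Suc n)
    let ?C = "\<Union>i\<in>{1..n}. ?A i" and ?B = "?A (Suc n)"
    have IH: "of_nat (N {}) - of_nat (N ?C) = (\<Sum>i=1..n. of_nat (N {}) - (of_nat (N (?A i)) :: rat))"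
      using Suc by simp
    have Sn: "Suc n \<in> {1..k}" using Suc.prems by simp
    have le: "i \<in> {1..k}" "Suc n \<noteq> i" if "i \<in> {1..n}" for i using that Suc.prems by auto
    have Un: "(\<Union>i\<in>{1..Suc n}. ?A i) = ?B \<union> ?C" by (simp add: atLeastAtMostSuc_conv)
    have "N (?B \<union> ?C) + N {} = N ?B + N ?C"
    \<comment> \<open>With no earlier summand \<open>?C\<close> is empty and the equation is
      trivial; otherwise a second summand is present and \<open>meet\<close> puts \<open>f\<close>
      in both.\<close>
    proof (cases "n = 0")
      case False
      then have one: "1 \<in> {1..n}" by simp
      have f: "f \<in> verts (H (Suc n))" "f \<in> verts (H 1)"
        using meet(1)[OF Sn le[OF one]] by blast+
      have f_face: "f \<in> faces G arev \<pi>0" using f(1) verts_faces[OF Sn] by blast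
      then obtain x where x: "f = orbit ?\<phi> x" by (auto simp: faces_def face_of_def)
      have out: "out_arcs (H i) f = ?A i \<inter> f" if "i \<in> {1..k}" for i
        using out_arcs_dual_subgraph[OF sub(1)[OF that] f_face] .
      have Bf: "?B \<inter> f \<noteq> {}" using ne[OF Sn f(1)] out[OF Sn] by simp
      have "?A 1 \<inter> f \<noteq> {}" using ne[OF le(1)[OF one] f(2)] out[OF le(1)[OF one]] by simp
      then have Cf: "?C \<inter> f \<noteq> {}" using one by blast
      have B_A: "?B \<subseteq> A" using A_Un Sn by blast
      have C_A: "?C \<subseteq> A" using A_Un le(1) by blast
      have "consecutive_in (inherited_rotation ?\<phi> A) (?B \<inter> f)"
        using bspec[OF assms(13) Sn] unfolding out[OF Sn] unstable_rotation_def dual_rotation_def A_def .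
      then obtain a m where "{(?\<phi> ^^ j) a | j. j < m} \<inter> A = ?B \<inter> f"
        using consecutive_in_interval[OF perm_face Bf, of A] B_A by blast
      \<comment> \<open>The interval was found relative to all unstable arcs; it separates
        \<open>?B\<close> from the smaller set \<open>?C\<close> as well.\<close>
      then have interval: "{(?\<phi> ^^ j) a | j. j < m} \<inter> (?B \<union> ?C) = ?B \<inter> f"
        using B_A C_A by blast
      show ?thesis unfolding N_def
      proof (rule card_strands_Un_interval[OF finite_arcs \<phi> arev_arev arev_neq _ _ _ _ _ x _ interval Bf Cf])
        show "?B \<subseteq> arcs G" "arev ` ?B \<subseteq> ?B" using A_arcs[OF Sn] sub(2)[OF Sn] .
        show "?C \<subseteq> arcs G" using A_arcs le(1) by blast
        show "arev ` ?C \<subseteq> ?C" using sub(2) le(1) by blast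
        show "?B \<inter> ?C = {}" using meet(2)[OF Sn] le by blast
        \<comment> \<open>A face meeting both arc sets is a common vertex of two summands, hence
          \<open>f\<close>.\<close>
        show "orbit ?\<phi> b = f" if "b \<in> ?B" "c \<in> ?C" "orbit ?\<phi> b = orbit ?\<phi> c" for b c
        proof -
          obtain i where i: "i \<in> {1..n}" "c \<in> ?A i" using \<open>c \<in> ?C\<close> by blast
          have "orbit ?\<phi> b \<in> verts (H (Suc n)) \<inter> verts (H i)"
            using face_in_verts[OF Sn that(1)] face_in_verts[OF le(1)[OF i(1)] i(2)] that(3) by simp
          then show ?thesis using meet(1)[OF Sn le(1)[OF i(1)]] le(2)[OF i(1)] by auto
        qed
      qed
    qed simp
    then have "of_nat (N (?B \<union> ?C)) + of_nat (N {}) = (of_nat (N ?B) + of_nat (N ?C) :: rat)"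
      by (metis of_nat_add)
    then show ?case unfolding Un using IH by (simp add: algebra_simps)
  qed simp
  show ?thesis
  proof (intro exI[of _ \<rho>] conjI ballI)
    fix i assume i: "i \<in> {1..k}"
    show "rotation_system G (\<rho> i)" unfolding \<rho>_def by (rule rotation_system_flip)
    show "unstable_dual G arev \<pi>0 (\<rho> i) = H i"
      unfolding \<rho>_def by (rule unstable_dual_flip[OF assms(4) sub(1)[OF i] ne[OF i] U[OF i]])
  next
    have "genus_diff G arev \<pi>0 \<pi> = (of_nat (N {}) - of_nat (N A)) / 2"
      by (subst \<pi>) (simp add: diff cut_W)
    also have "\<dots> = (\<Sum>i=1..k. of_nat (N {}) - of_nat (N (?A i))) / 2"
      using sum[of k] A_Un by simp
    also have "\<dots> = (\<Sum>i=1..k. genus_diff G arev \<pi>0 (\<rho> i))"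
      unfolding sum_divide_distrib \<rho>_def diff by (intro sum.cong) (simp_all add: U)
    finally show "genus_diff G arev \<pi>0 \<pi> = (\<Sum>i=1..k. genus_diff G arev \<pi>0 (\<rho> i))" .
  qed
qed

end
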